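(* Let $\alpha:\mathbb{N}\to e$ be the unique homomorphism from the additive monoid $\mathbb{N}$ of natural numbers to the trivial monoid. Then \[ \mathrm{Barr}^5(\widetilde{\mathbb{Z}}\mathbb{N};\alpha^*\mathbb{F}_2)\cong\mathrm{Barr}^5(\mathbb{Z}[x];\mathbb{F}_2), \] and this group is nontrivial.
   Context: **Graded objects.** Let $X$ be a commutative monoid and $K$ a commutative ring. An $X$-graded $K$-module is a family $(V_x)_{x\in X}$ of $K$-modules, with $(V\otimes_K W)_z=\bigoplus_{x+y=z}V_x\otimes_K W_y$. A commutative $X$-graded $K$-algebra is a commutative monoid for $\otimes_K$ (symmetry without signs). A left $A$-module $M$ is an $X$-graded $K$-module with action $A_y\otimes M_x\to M_{x+y}$. Taking $X=e$ gives ordinary commutative $K$-algebras and modules. **Barr cohomology.** Let $A$ be a commutative $X$-graded $K$-algebra and $M$ a left $A$-module. Hochschild $n$-cochains ($n\ge1$) are degree-preserving $K$-linear maps $s:A^{\otimes n}\to M$, with differential \[ (\delta s)(a_1,\dots,a_{n+1})=a_1s(a_2,\dots,a_{n+1})+\sum_{i=1}^n(-1)^is(\dots,a_ia_{i+1},\dots)+(-1)^{n+1}a_{n+1}s(a_1,\dots,a_n). \] A Barr $n$-cochain is a Hochschild $n$-cochain $s$ such that: (i) (Harrison condition) $s$ vanishes on shuffle decomposables: for all $i,j\ge1$ with $i+j=n$, $\sum_{\sigma\in\Sigma(i,j)}\mathrm{sgn}(\sigma)\,s\circ\sigma=0$, where $\Sigma(i,j)\subseteq\Sigma_n$ is the set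 of permutations preserving the order of $\{1,\dots,i\}$ and of $\{i+1,\dots,n\}$, acting by permuting the tensor factors; (ii) $s(\gamma_k[a_1|\cdots|a_m])=0$ for all $k\ge2$ and all even $m\ge2$ with $km=n$, and all homogeneous $a_1,\dots,a_m\in A$. Here \[ \gamma_k[a_1|\cdots|a_m]=\sum_{\sigma}\mathrm{sgn}(\sigma)\,[a_1|\cdots|a_m|a_1|\cdots|a_m|\cdots|a_1|\cdots|a_m]\circ\sigma \] ($a_1|\cdots|a_m$ repeated $k$ times), and $\sigma$ runs over the shuffles of the $k$ consecutive blocks of length $m$ (permutations preserving the order within each block) for which the leading terms of the $k$ blocks occur in order in the shuffled word. Bars denote tensor signs. For example $\gamma_2[a|b]=[a|b|a|b]$, so for $n=4$ condition (ii) reads $s(a,b,a,b)=0$. Barr cochains form a subcomplex of the Hochschild cochain complex (in degrees $n\geq 1$), and $\mathrm{Barr}^n(A;M)$ is its cohomology in degree $n$. **The objects in the claim.** $\widetilde{\mathbb{Z}}\mathbb{N}$ is the commutative $\mathbb{N}$-graded $\mathbb{Z}$-algebra with $(\widetilde{\mathbb{Z}}\mathbb{N})_i=\mathbb{Z}\cdot1_i$ and $1_i1_j=1_{i+j}$. $\alpha^*\mathbb{F}_2$ is the constant module with $(\alpha^*\mathbb{F}_2)_i=\mathbb{F}_2$ for all $i$ and each $1_j$ acting as the identity map $\mathbb{F}_2\to\mathbb{F}_2$. $\mathbb{Z}[x]$ is the ungraded polynomial ring over $K=\mathbb{Z}$ (the monoid ring of $\mathbb{N}$), and $\mathbb{F}_2$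 is the $\mathbb{Z}[x]$-module on which $x$ acts as the identity. *)

theory Defs
  imports
    "HOL-Library.Z2"
    "HOL-Computational_Algebra.Polynomial"
    "HOL-Combinatorics.Permutations"
    "HOL-Algebra.IntRing"
    "HOL-Algebra.Module"
    "HOL-Algebra.Product_Groups"
begin

section \<open>Graded algebras and graded modules\<close>

text \<open>Only the additive part and the scalar multiplication of a component are used; the ring
  multiplication and unit that its record type also carries are ignored. The monoid of degrees \<open>X\<close>
  is written multiplicatively. The structure maps \<open>A\<^sub>x \<otimes> A\<^sub>y \<rightarrow> A\<^sub>x\<^sub>+\<^sub>y\<close> and \<open>A\<^sub>y \<otimes> M\<^sub>x \<rightarrow> M\<^sub>x\<^sub>+\<^sub>y\<close> are
  given as the corresponding bilinear maps, indexed by the degrees of their arguments.\<close>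

record ('x, 'k, 'a) graded_alg =
  alg_comp :: "'x \<Rightarrow> ('k, 'a) module"
  alg_mult :: "'x \<Rightarrow> 'x \<Rightarrow> 'a \<Rightarrow> 'a \<Rightarrow> 'a"
  alg_one :: 'a

record ('x, 'k, 'a, 'm) graded_mod =
  mod_comp :: "'x \<Rightarrow> ('k, 'm) module"
  mod_act :: "'x \<Rightarrow> 'x \<Rightarrow> 'a \<Rightarrow> 'm \<Rightarrow> 'm"

definition bilinear_map ::
    "'k ring \<Rightarrow> ('k, 'u) module \<Rightarrow> ('k, 'v) module \<Rightarrow> ('k, 'w) module \<Rightarrow> ('u \<Rightarrow> 'v \<Rightarrow> 'w) \<Rightarrow> bool"
  where "bilinear_map K U V W f \<longleftrightarrow>
    (\<forall>u \<in> carrier U. \<forall>v \<in> carrier V. f u v \<in> carrier W) \<and>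
    (\<forall>u \<in> carrier U. \<forall>u' \<in> carrier U. \<forall>v \<in> carrier V. f (u \<oplus>\<^bsub>U\<^esub> u') v = f u v \<oplus>\<^bsub>W\<^esub> f u' v) \<and>
    (\<forall>u \<in> carrier U. \<forall>v \<in> carrier V. \<forall>v' \<in> carrier V. f u (v \<oplus>\<^bsub>V\<^esub> v') = f u v \<oplus>\<^bsub>W\<^esub> f u v') \<and>
    (\<forall>k \<in> carrier K. \<forall>u \<in> carrier U. \<forall>v \<in> carrier V. f (k \<odot>\<^bsub>U\<^esub> u) v = k \<odot>\<^bsub>W\<^esub> f u v) \<and>
    (\<forall>k \<in> carrier K. \<forall>u \<in> carrier U. \<forall>v \<in> carrier V. f u (k \<odot>\<^bsub>V\<^esub> v) = k \<odot>\<^bsub>W\<^esub> f u v)"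

locale comm_graded_algebra =
  fixes X :: "'x monoid" and K :: "'k ring" and A :: "('x, 'k, 'a) graded_alg"
  assumes degrees: "comm_monoid X"
    and scalars: "cring K"
    and alg_module: "x \<in> carrier X \<Longrightarrow> Module.module K (alg_comp A x)"
    and alg_bilinear: "\<lbrakk>x \<in> carrier X; y \<in> carrier X\<rbrakk> \<Longrightarrow>
      bilinear_map K (alg_comp A x) (alg_comp A y) (alg_comp A (x \<otimes>\<^bsub>X\<^esub> y)) (alg_mult A x y)"
    and alg_one_closed: "alg_one A \<in> carrier (alg_comp A \<one>\<^bsub>X\<^esub>)"
    and alg_assoc: "\<lbrakk>x \<in> carrier X; y \<in> carrier X; z \<in> carrier X;
        a \<in> carrier (alg_comp A x); b \<in> carrier (alg_comp A y); c \<in> carrier (alg_comp A z)\<rbrakk> \<Longrightarrow>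
      alg_mult A (x \<otimes>\<^bsub>X\<^esub> y) z (alg_mult A x y a b) c =
      alg_mult A x (y \<otimes>\<^bsub>X\<^esub> z) a (alg_mult A y z b c)"
    and alg_comm: "\<lbrakk>x \<in> carrier X; y \<in> carrier X;
        a \<in> carrier (alg_comp A x); b \<in> carrier (alg_comp A y)\<rbrakk> \<Longrightarrow>
      alg_mult A x y a b = alg_mult A y x b a"
    and alg_l_one: "\<lbrakk>x \<in> carrier X; a \<in> carrier (alg_comp A x)\<rbrakk> \<Longrightarrow>
      alg_mult A \<one>\<^bsub>X\<^esub> x (alg_one A) a = a"

locale graded_module = comm_graded_algebra X K A
  for X :: "'x monoid" and K :: "'k ring" and A :: "('x, 'k, 'a) graded_alg" +
  fixes M :: "('x, 'k, 'a, 'm) graded_mod"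
  assumes mod_module: "x \<in> carrier X \<Longrightarrow> Module.module K (mod_comp M x)"
    and act_bilinear: "\<lbrakk>y \<in> carrier X; x \<in> carrier X\<rbrakk> \<Longrightarrow>
      bilinear_map K (alg_comp A y) (mod_comp M x) (mod_comp M (x \<otimes>\<^bsub>X\<^esub> y)) (mod_act M y x)"
    and act_assoc: "\<lbrakk>x \<in> carrier X; y \<in> carrier X; z \<in> carrier X;
        a \<in> carrier (alg_comp A x); b \<in> carrier (alg_comp A y); v \<in> carrier (mod_comp M z)\<rbrakk> \<Longrightarrow>
      mod_act M (x \<otimes>\<^bsub>X\<^esub> y) z (alg_mult A x y a b) v =
      mod_act M x (y \<otimes>\<^bsub>X\<^esub> z) a (mod_act M y z b v)"
    and act_one: "\<lbrakk>x \<in> carrier X; v \<in> carrier (mod_comp M x)\<rbrakk> \<Longrightarrow>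
      mod_act M \<one>\<^bsub>X\<^esub> x (alg_one A) v = v"


section \<open>Hochschild cochains\<close>

text \<open>A homogeneous element of \<open>A\<close> is a pair of a degree \<open>x\<close> and an element of \<open>A\<^sub>x\<close>; a word
  \<open>[(x\<^sub>1, a\<^sub>1), \<dots>, (x\<^sub>n, a\<^sub>n)]\<close> stands for the tensor \<open>[a\<^sub>1|\<dots>|a\<^sub>n]\<close>. By the universal property of
  \<open>\<otimes>\<^sub>K\<close> and of direct sums, a degree-preserving \<open>K\<close>-linear map \<open>A\<^sup>\<otimes>\<^sup>n \<rightarrow> M\<close> is the same as a family
  of \<open>K\<close>-multilinear maps \<open>A\<^sub>x\<^sub>1 \<times> \<dots> \<times> A\<^sub>x\<^sub>n \<rightarrow> M\<^sub>z\<close>, \<open>z = x\<^sub>1 + \<dots> + x\<^sub>n\<close>, that is, a function on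
  words which is linear in each letter of fixed degree. Cochains are \<^const>\<open>undefined\<close> outside the
  words of the given length, so that equality of cochains is equality of functions.\<close>

definition words :: "'x monoid \<Rightarrow> ('x, 'k, 'a) graded_alg \<Rightarrow> nat \<Rightarrow> ('x \<times> 'a) list set"
  where "words X A n =
    {w. length w = n \<and> set w \<subseteq> (SIGMA x : carrier X. carrier (alg_comp A x))}"

definition word_deg :: "'x monoid \<Rightarrow> ('x \<times> 'a) list \<Rightarrow> 'x"
  where "word_deg X w = foldr (\<lambda>u d. fst u \<otimes>\<^bsub>X\<^esub> d) w \<one>\<^bsub>X\<^esub>"

abbreviation target ::
    "'x monoid \<Rightarrow> ('x, 'k, 'a, 'm) graded_mod \<Rightarrow> ('x \<times> 'a) list \<Rightarrow> ('k, 'm) module"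
  where "target X M w \<equiv> mod_comp M (word_deg X w)"

definition hochschild_cochains ::
    "'x monoid \<Rightarrow> 'k ring \<Rightarrow> ('x, 'k, 'a) graded_alg \<Rightarrow> ('x, 'k, 'a, 'm) graded_mod \<Rightarrow> nat \<Rightarrow>
      (('x \<times> 'a) list \<Rightarrow> 'm) set"
  where "hochschild_cochains X K A M n =
    {s \<in> (\<Pi>\<^sub>E w \<in> words X A n. carrier (target X M w)).
      (\<forall>p q x. \<forall>a \<in> carrier (alg_comp A x). \<forall>b \<in> carrier (alg_comp A x).
        p @ (x, a) # q \<in> words X A n \<longrightarrow>
          s (p @ (x, a \<oplus>\<^bsub>alg_comp A x\<^esub> b) # q) =
          s (p @ (x, a) # q) \<oplus>\<^bsub>target X M (p @ (x, a) # q)\<^esub> s (p @ (x, b) # q)) \<and>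
      (\<forall>p q x. \<forall>k \<in> carrier K. \<forall>a \<in> carrier (alg_comp A x).
        p @ (x, a) # q \<in> words X A n \<longrightarrow>
          s (p @ (x, k \<odot>\<^bsub>alg_comp A x\<^esub> a) # q) =
          k \<odot>\<^bsub>target X M (p @ (x, a) # q)\<^esub> s (p @ (x, a) # q))}"

text \<open>\<open>merge A i\<close> sends \<open>[a\<^sub>1|\<dots>|a\<^sub>n]\<close> to \<open>[\<dots>|a\<^sub>i a\<^sub>i\<^sub>+\<^sub>1|\<dots>]\<close>; positions are counted from 1 as in
  the formula for the differential.\<close>

definition merge ::
    "'x monoid \<Rightarrow> ('x, 'k, 'a) graded_alg \<Rightarrow> nat \<Rightarrow> ('x \<times> 'a) list \<Rightarrow> ('x \<times> 'a) list"
  where "merge X A i w =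
    (let (x, a) = w ! (i - 1); (y, b) = w ! i
     in take (i - 1) w @ (x \<otimes>\<^bsub>X\<^esub> y, alg_mult A x y a b) # drop (i + 1) w)"

definition letter_act ::
    "'x monoid \<Rightarrow> ('x, 'k, 'a, 'm) graded_mod \<Rightarrow> 'x \<times> 'a \<Rightarrow> ('x \<times> 'a) list \<Rightarrow> 'm \<Rightarrow> 'm"
  where "letter_act X M u w v = mod_act M (fst u) (word_deg X w) (snd u) v"

definition hochschild_diff ::
    "'x monoid \<Rightarrow> ('x, 'k, 'a) graded_alg \<Rightarrow> ('x, 'k, 'a, 'm) graded_mod \<Rightarrow> nat \<Rightarrow>
      (('x \<times> 'a) list \<Rightarrow> 'm) \<Rightarrow> (('x \<times> 'a) list \<Rightarrow> 'm)"
  where "hochschild_diff X A M n s =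
    (\<lambda>w \<in> words X A (n + 1).
      letter_act X M (hd w) (tl w) (s (tl w))
      \<oplus>\<^bsub>target X M w\<^esub>
      (\<Oplus>\<^bsub>target X M w\<^esub> i \<in> {1..n}. [((- 1) ^ i :: int)] \<cdot>\<^bsub>target X M w\<^esub> s (merge X A i w))
      \<oplus>\<^bsub>target X M w\<^esub>
      [((- 1) ^ (n + 1) :: int)] \<cdot>\<^bsub>target X M w\<^esub>
        letter_act X M (last w) (butlast w) (s (butlast w)))"


section \<open>Barr cochains and Barr cohomology\<close>

text \<open>Permutations act on positions \<open>0, \<dots>, n - 1\<close>, and \<open>\<sigma>\<close> moves the letter in position \<open>p\<close> to
  position \<open>\<sigma> p\<close>; this is the convention for which the permutations that preserve the order of
  consecutive blocks of positions produce the shuffles of the corresponding subwords.\<close>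

definition permute_word :: "(nat \<Rightarrow> nat) \<Rightarrow> 'b list \<Rightarrow> 'b list"
  where "permute_word \<sigma> w = permute_list (inv_into UNIV \<sigma>) w"

definition two_shuffles :: "nat \<Rightarrow> nat \<Rightarrow> (nat \<Rightarrow> nat) set"
  where "two_shuffles i j =
    {\<sigma>. \<sigma> permutes {..<i + j} \<and> strict_mono_on {..<i} \<sigma> \<and> strict_mono_on {i..<i + j} \<sigma>}"

definition ordered_block_shuffles :: "nat \<Rightarrow> nat \<Rightarrow> (nat \<Rightarrow> nat) set"
  where "ordered_block_shuffles k m =
    {\<sigma>. \<sigma> permutes {..<k * m} \<and>
      (\<forall>b < k. strict_mono_on {b * m..<(b + 1) * m} \<sigma>) \<and>
      (\<forall>b c. b < c \<and> c < k \<longrightarrow> \<sigma> (b * m) < \<sigma> (c * m))}"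

text \<open>The value of a cochain on the signed sum of the rearrangements \<open>w \<circ> \<sigma>\<close>, \<open>\<sigma> \<in> S\<close>. If the degrees
  form a commutative monoid, all the terms lie in the same component of \<open>M\<close>.\<close>

definition signed_sum ::
    "'x monoid \<Rightarrow> ('x, 'k, 'a, 'm) graded_mod \<Rightarrow> (('x \<times> 'a) list \<Rightarrow> 'm) \<Rightarrow>
      (nat \<Rightarrow> nat) set \<Rightarrow> ('x \<times> 'a) list \<Rightarrow> 'm"
  where "signed_sum X M s S w =
    (\<Oplus>\<^bsub>target X M w\<^esub> \<sigma> \<in> S. [(sign \<sigma>)] \<cdot>\<^bsub>target X M w\<^esub> s (permute_word \<sigma> w))"

definition barr_cochains ::
    "'x monoid \<Rightarrow> 'k ring \<Rightarrow> ('x, 'k, 'a) graded_alg \<Rightarrow> ('x, 'k, 'a, 'm) graded_mod \<Rightarrow> nat \<Rightarrow>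
      (('x \<times> 'a) list \<Rightarrow> 'm) set"
  where "barr_cochains X K A M n =
    {s \<in> hochschild_cochains X K A M n.
      (\<forall>i j. 1 \<le> i \<and> 1 \<le> j \<and> i + j = n \<longrightarrow>
        (\<forall>w \<in> words X A n. signed_sum X M s (two_shuffles i j) w = \<zero>\<^bsub>target X M w\<^esub>)) \<and>
      (\<forall>k m. 2 \<le> k \<and> 2 \<le> m \<and> even m \<and> k * m = n \<longrightarrow>
        (\<forall>v \<in> words X A m.
          signed_sum X M s (ordered_block_shuffles k m) (concat (replicate k v)) =
          \<zero>\<^bsub>target X M (concat (replicate k v))\<^esub>))}"

definition word_functions ::
    "'x monoid \<Rightarrow> ('x, 'k, 'a) graded_alg \<Rightarrow> ('x, 'k, 'a, 'm) graded_mod \<Rightarrow> nat \<Rightarrow>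
      (('x \<times> 'a) list \<Rightarrow> 'm) monoid"
  where "word_functions X A M n =
    product_group (words X A n) (\<lambda>w. add_monoid (target X M w))"

definition barr_cocycles ::
    "'x monoid \<Rightarrow> 'k ring \<Rightarrow> ('x, 'k, 'a) graded_alg \<Rightarrow> ('x, 'k, 'a, 'm) graded_mod \<Rightarrow> nat \<Rightarrow>
      (('x \<times> 'a) list \<Rightarrow> 'm) set"
  where "barr_cocycles X K A M n =
    {s \<in> barr_cochains X K A M n.
      hochschild_diff X A M n s = \<one>\<^bsub>word_functions X A M (n + 1)\<^esub>}"

text \<open>The complex starts in degree 1, so there are no nonzero coboundaries in degree 1.\<close>

definition barr_coboundaries ::
    "'x monoid \<Rightarrow> 'k ring \<Rightarrow> ('x, 'k, 'a) graded_alg \<Rightarrow> ('x, 'k, 'a, 'm) graded_mod \<Rightarrow> nat \<Rightarrow>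
      (('x \<times> 'a) list \<Rightarrow> 'm) set"
  where "barr_coboundaries X K A M n =
    (if n \<le> 1 then {\<one>\<^bsub>word_functions X A M n\<^esub>}
     else hochschild_diff X A M (n - 1) ` barr_cochains X K A M (n - 1))"

definition Barr ::
    "'x monoid \<Rightarrow> 'k ring \<Rightarrow> ('x, 'k, 'a) graded_alg \<Rightarrow> ('x, 'k, 'a, 'm) graded_mod \<Rightarrow> nat \<Rightarrow>
      (('x \<times> 'a) list \<Rightarrow> 'm) set monoid"
  where "Barr X K A M n =
    (word_functions X A M n)\<lparr>carrier := barr_cocycles X K A M n\<rparr> Mod barr_coboundaries X K A M n"


section \<open>The algebras and modules in the theorem\<close>

definition class_module :: "(int, 'b :: comm_ring_1) module"
  where "class_module =
    \<lparr>carrier = UNIV, mult = (*), one = 1, zero = 0, add = (+), smult = (\<lambda>k v. of_int k * v)\<rparr>"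

abbreviation nat_degrees :: "nat monoid"
  where "nat_degrees \<equiv> \<lparr>carrier = UNIV, mult = (+), one = 0\<rparr>"

abbreviation trivial_degrees :: "unit monoid"
  where "trivial_degrees \<equiv> singleton_group ()"

text \<open>The integer \<open>k\<close> in degree \<open>i\<close> represents \<open>k \<cdot> 1\<^sub>i\<close>.\<close>

definition ZN :: "(nat, int, int) graded_alg"
  where "ZN = \<lparr>alg_comp = (\<lambda>_. class_module), alg_mult = (\<lambda>_ _. (*)), alg_one = 1\<rparr>"

definition constant_F2 :: "(nat, int, int, bit) graded_mod"
  where "constant_F2 =
    \<lparr>mod_comp = (\<lambda>_. class_module), mod_act = (\<lambda>_ _ k v. of_int k * v)\<rparr>"

definition Zx :: "(unit, int, int poly) graded_alg"
  where "Zx = \<lparr>alg_comp = (\<lambda>_. class_module), alg_mult = (\<lambda>_ _. (*)), alg_one = 1\<rparr>"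

text \<open>Since \<open>x\<close> acts as the identity, a polynomial acts as multiplication by its value at 1.\<close>

definition F2_over_Zx :: "(unit, int, int poly, bit) graded_mod"
  where "F2_over_Zx =
    \<lparr>mod_comp = (\<lambda>_. class_module), mod_act = (\<lambda>_ _ p v. of_int (poly p 1) * v)\<rparr>"

lemma module_class_module: "Module.module \<Z> (class_module :: (int, 'b :: comm_ring_1) module)"
proof (rule Module.moduleI)
  show "abelian_group (class_module :: (int, 'b) module)"
  proof (rule abelian_groupI)
    fix v :: 'b
    show "\<exists>u \<in> carrier (class_module :: (int, 'b) module). u \<oplus>\<^bsub>class_module\<^esub> v = \<zero>\<^bsub>class_module\<^esub>"
      by (rule bexI [of _ "- v"]) (simp_all add: class_module_def)
  qed (simp_all add: class_module_def ac_simps)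
qed (simp_all add: class_module_def int_is_cring algebra_simps)

lemma bilinear_map_mult:
  "bilinear_map \<Z> class_module class_module class_module ((*) :: 'b \<Rightarrow> 'b \<Rightarrow> 'b :: comm_ring_1)"
  by (simp add: bilinear_map_def class_module_def algebra_simps)

lemma bilinear_map_scale:
  assumes "\<And>a b. f (a + b) = f a + f b" and "\<And>k a. f (of_int k * a) = k * f a"
  shows "bilinear_map \<Z> (class_module :: (int, 'a :: comm_ring_1) module) class_module
    (class_module :: (int, 'b :: comm_ring_1) module) (\<lambda>a v. of_int (f a) * v)"
  by (simp add: bilinear_map_def class_module_def assms distrib_left distrib_right mult.assoc mult.left_commute)

lemma graded_module_ZN: "graded_module nat_degrees \<Z> ZN constant_F2"
proof (intro graded_module.intro comm_graded_algebra.intro graded_module_axioms.intro)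
  show "comm_monoid nat_degrees"
    by (rule comm_monoidI) simp_all
qed (simp_all add: ZN_def constant_F2_def module_class_module int_is_cring bilinear_map_mult
       bilinear_map_scale [of "\<lambda>k. k"]
       del: mult_bit_eq_and,
     simp_all add: class_module_def algebra_simps)

lemma graded_module_Zx: "graded_module trivial_degrees \<Z> Zx F2_over_Zx"
proof (intro graded_module.intro comm_graded_algebra.intro graded_module_axioms.intro)
  show "comm_monoid trivial_degrees"
    using singleton_abelian_group by (rule comm_group.axioms)
qed (simp_all add: Zx_def F2_over_Zx_def module_class_module int_is_cring bilinear_map_mult
       bilinear_map_scale [of "\<lambda>p. poly p 1"]
       del: mult_bit_eq_and,
     simp_all add: class_module_def algebra_simps)

end

theory Submission
  imports Defs
begin

text \<open>Since the coefficients have two elements, all signs disappear. For both algebras a Hochschild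
  \<open>n\<close>-cochain amounts to a function \<open>\<nat>\<^sup>n \<rightarrow> \<F>\<close> to the field of two elements: its values on the
  words in the \<open>1\<^sub>i\<close>, or in the monomials \<open>x\<^sup>i\<close>. Thus pulling back along \<open>1\<^sub>i \<mapsto> x\<^sup>i\<close>, which respects
  products and the actions, is an isomorphism of Hochschild complexes
  (\<open>bij_betw_monomial_restriction\<close>, \<open>hochschild_diff_monomial_restriction\<close>). The cocycle condition and
  the Harrison condition are linear in each letter and can be checked on monomials. The condition
  \<open>s(a,b,a,b) = 0\<close> in degree 4 is quadratic in \<open>a\<close> and in \<open>b\<close>, but modulo 2 its polarizations are
  instances of the Harrison condition for \<open>(2,2)\<close>-shuffles, so it can be checked on monomials as well
  (\<open>vanishes_on_squares\<close>). In degree 5 there is no such condition, because 5 has no even divisor.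
  This proves the isomorphism.

  For the nontriviality put \<open>t = x - 1\<close>, and let \<open>e(p)\<close> and \<open>q(p)\<close> be the coefficients modulo 2 of \<open>t\<close> and \<open>t\<^sup>2\<close>
  in the polynomial \<open>p\<close>. The cochain \<open>g = q\<otimes>q\<otimes>q\<otimes>q\<close> is symmetric, so it takes the sum of the
  \<open>(i,4-i)\<close>-shuffles of a word to a multiple of the binomial coefficient of 4 over \<open>i\<close>, which is even for
  \<open>0 < i < 4\<close>. Hence \<open>g\<close> satisfies the Harrison condition; but it is not a Barr cochain, because
  \<open>g(a,b,a,b) = q(a)q(b)\<close>. Its coboundary
  \<open>eeqqq + qeeqq + qqeeq + qqqee\<close> (tensor signs omitted) is a Barr cocycle. It is not
  the coboundary of a Barr cochain, as the following pairing shows. Write \<open>[i|j|\<dots>]\<close> for the word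
  \<open>[t\<^sup>i|t\<^sup>j|\<dots>]\<close>. Up to shuffle decomposables, the boundary of
  \<open>[1|1|1|1|4] + [1|1|1|2|3] + [1|1|2|1|3] + [1|1|2|2|2]\<close> is \<open>[2|2|2|2] + [1|3|1|3]\<close>, on which every Barr
  4-cochain vanishes, whereas the coboundary of \<open>g\<close> has the value 1 on this chain
  (\<open>exotic_cocycle_not_coboundary\<close>).\<close>

text \<open>The default rewriting of sums and products of bits into bitwise operations would prevent the
  normalization of polynomial expressions in bits.\<close>

declare add_bit_eq_xor [simp del] mult_bit_eq_and [simp del]

lemma bit_add_self [simp]: "x + x = (0 :: bit)"
  by (cases x) simp_all

lemma bit_add_left_self [simp]: "x + (x + y) = (y :: bit)"
  by (simp flip: add.assoc)

lemma bit_add_eq_0_iff: "x + y = 0 \<longleftrightarrow> x = (y :: bit)"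
  by (cases x; cases y) simp_all

section \<open>Sums over the shuffles of two words\<close>

text \<open>The recursion takes the first letter of the shuffled word from either of the two words. Unlike a
  sum over the set \<^const>\<open>shuffles\<close>, it counts a word as often as it arises, which matters as
  soon as letters are repeated.\<close>

fun shuffle_sum :: "('l list \<Rightarrow> 'b :: comm_monoid_add) \<Rightarrow> 'l list \<Rightarrow> 'l list \<Rightarrow> 'b"
  where
    "shuffle_sum s [] v = s v"
  | "shuffle_sum s u [] = s u"
  | "shuffle_sum s (a # u) (b # v) =
      shuffle_sum (\<lambda>w. s (a # w)) u (b # v) + shuffle_sum (\<lambda>w. s (b # w)) (a # u) v"

lemma shuffle_sum_Nil2 [simp]: "shuffle_sum s u [] = s u"
  by (cases u) simp_all

lemma shuffle_sum_eq_sum_shuffles: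
  assumes "set u \<inter> set v = {}"
  shows "shuffle_sum s u v = sum s (shuffles u v)"
  using assms
proof (induction s u v rule: shuffle_sum.induct)
  case (3 s a u b v)
  have "sum s (shuffles (a # u) (b # v)) =
      sum s ((#) a ` shuffles u (b # v)) + sum s ((#) b ` shuffles (a # u) v)"
    unfolding shuffles.simps using "3.prems" by (intro sum.union_disjoint) auto
  also have "sum s ((#) a ` shuffles u (b # v)) = shuffle_sum (\<lambda>w. s (a # w)) u (b # v)"
    using 3 by (simp add: sum.reindex o_def)
  also have "sum s ((#) b ` shuffles (a # u) v) = shuffle_sum (\<lambda>w. s (b # w)) (a # u) v"
    using 3 by (simp add: sum.reindex o_def)
  finally show ?case
    by simp
qed simp_all

lemma shuffle_sum_map: "shuffle_sum (\<lambda>w. s (map f w)) u v = shuffle_sum s (map f u) (map f v)"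
proof (induction "\<lambda>w. s (map f w)" u v arbitrary: s rule: shuffle_sum.induct)
  case (3 a u b v)
  show ?case
    using 3(1) [of "\<lambda>w. s (f a # w)"] 3(2) [of "\<lambda>w. s (f b # w)"] by simp
qed simp_all

lemma shuffle_sum_cong:
  assumes "\<And>w. length w = length u + length v \<Longrightarrow> s w = t w"
  shows "shuffle_sum s u v = shuffle_sum t u v"
  using assms
proof (induction s u v arbitrary: t rule: shuffle_sum.induct)
  case (3 s a u b v)
  show ?case
    using 3(1) [of "\<lambda>w. t (a # w)"] 3(2) [of "\<lambda>w. t (b # w)"] 3(3) by simp
qed simp_all

lemma shuffle_sum_add: "shuffle_sum (\<lambda>w. s w + t w) u v = shuffle_sum s u v + shuffle_sum t u v"
proof (induction s u v arbitrary: t rule: shuffle_sum.induct)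
  case (3 s a u b v)
  show ?case
    using 3(1) [of "\<lambda>w. t (a # w)"] 3(2) [of "\<lambda>w. t (b # w)"] by (simp add: ac_simps)
qed simp_all

lemma shuffle_sum_commute: "shuffle_sum s u v = shuffle_sum s v u"
  by (induction s u v rule: shuffle_sum.induct) (simp_all add: add.commute)


section \<open>Multiadditive functions on words\<close>

definition multiadditive :: "nat \<Rightarrow> (('x \<times> 'a :: plus) list \<Rightarrow> 'b :: plus) \<Rightarrow> bool"
  where "multiadditive n s \<longleftrightarrow>
    (\<forall>p x a b q. length p + length q + 1 = n \<longrightarrow>
      s (p @ (x, a + b) # q) = s (p @ (x, a) # q) + s (p @ (x, b) # q))"

lemma multiadditiveD:
  "multiadditive n s \<Longrightarrow> length p + length q + 1 = n \<Longrightarrow>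
    s (p @ (x, a + b) # q) = s (p @ (x, a) # q) + s (p @ (x, b) # q)"
  by (simp add: multiadditive_def)

lemma multiadditive_Cons:
  assumes "multiadditive (Suc n) s"
  shows "multiadditive n (\<lambda>w. s (l # w))"
  unfolding multiadditive_def using multiadditiveD [OF assms, of "l # _"] by simp

lemma multiadditive_Cons_head:
  "multiadditive (Suc n) s \<Longrightarrow> length w = n \<Longrightarrow> s ((x, a + b) # w) = s ((x, a) # w) + s ((x, b) # w)"
  using multiadditiveD [of "Suc n" s "[]" w] by simp

lemma multiadditive_cong:
  assumes "\<And>w. length w = n \<Longrightarrow> s w = t w"
  shows "multiadditive n s \<longleftrightarrow> multiadditive n t"
  using assms by (simp add: multiadditive_def)

lemma multiadditive_add:
  fixes s t :: "('x \<times> 'a :: plus) list \<Rightarrow> 'b :: comm_monoid_add"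
  shows "multiadditive n s \<Longrightarrow> multiadditive n t \<Longrightarrow> multiadditive n (\<lambda>w. s w + t w)"
  by (simp add: multiadditive_def ac_simps)

lemma multiadditive_sum:
  fixes s :: "'i \<Rightarrow> ('x \<times> 'a :: plus) list \<Rightarrow> 'b :: comm_monoid_add"
  shows "(\<And>i. i \<in> I \<Longrightarrow> multiadditive n (s i)) \<Longrightarrow> multiadditive n (\<lambda>w. \<Sum>i \<in> I. s i w)"
  by (simp add: multiadditive_def sum.distrib)

lemma shuffle_sum_multiadditive_left:
  fixes s :: "('x \<times> 'a :: plus) list \<Rightarrow> 'b :: comm_monoid_add"
  assumes "multiadditive (length p + length q + 1 + length v) s"
  shows "shuffle_sum s (p @ (x, a + b) # q) v =
    shuffle_sum s (p @ (x, a) # q) v + shuffle_sum s (p @ (x, b) # q) v"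
  using assms
proof (induction "length p + length v" arbitrary: s p v)
  case 0
  then show ?case
    using multiadditiveD [OF 0(2), of "[]" q] by simp
next
  case (Suc m)
  show ?case
  proof (cases v)
    case Nil
    then show ?thesis
      using multiadditiveD [OF Suc.prems, of p q] by simp
  next
    case v: (Cons c v')
    have tail: "multiadditive (length p + length q + 1 + length v') (\<lambda>w. s (c # w))"
      using Suc.prems v by (intro multiadditive_Cons) simp
    have IH: "shuffle_sum (\<lambda>w. s (c # w)) (p @ (x, a + b) # q) v' =
        shuffle_sum (\<lambda>w. s (c # w)) (p @ (x, a) # q) v' + shuffle_sum (\<lambda>w. s (c # w)) (p @ (x, b) # q) v'"
      using Suc.hyps(2) v by (intro Suc.hyps(1) tail) simp_all
    show ?thesis
    proof (cases p)
      case Nil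
      have "shuffle_sum (\<lambda>w. s ((x, a + b) # w)) q v =
          shuffle_sum (\<lambda>w. s ((x, a) # w) + s ((x, b) # w)) q v"
        by (rule shuffle_sum_cong, rule multiadditive_Cons_head [of "length q + length v"])
          (use Suc.prems Nil in simp_all)
      then show ?thesis
        using IH Nil v by (simp add: shuffle_sum_add ac_simps)
    next
      case (Cons d p')
      have "multiadditive (length p' + length q + 1 + length v) (\<lambda>w. s (d # w))"
        using Suc.prems Cons by (intro multiadditive_Cons) simp
      then have "shuffle_sum (\<lambda>w. s (d # w)) (p' @ (x, a + b) # q) v =
          shuffle_sum (\<lambda>w. s (d # w)) (p' @ (x, a) # q) v + shuffle_sum (\<lambda>w. s (d # w)) (p' @ (x, b) # q) v"
        using Suc.hyps(2) Cons by (intro Suc.hyps(1)) simp_all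
      then show ?thesis
        using IH Cons v by (simp add: ac_simps)
    qed
  qed
qed

lemma multiadditive_shuffle_sum:
  fixes s :: "('x \<times> 'a :: plus) list \<Rightarrow> 'b :: comm_monoid_add"
  assumes "multiadditive n s"
  shows "multiadditive n (\<lambda>w. shuffle_sum s (take i w) (drop i w))"
  unfolding multiadditive_def
proof (intro allI impI)
  fix p q :: "('x \<times> 'a) list" and x a b
  assume n: "length p + length q + 1 = n"
  show "shuffle_sum s (take i (p @ (x, a + b) # q)) (drop i (p @ (x, a + b) # q)) =
    shuffle_sum s (take i (p @ (x, a) # q)) (drop i (p @ (x, a) # q)) +
    shuffle_sum s (take i (p @ (x, b) # q)) (drop i (p @ (x, b) # q))"
  proof (cases "i \<le> length p")
    case True
    have "multiadditive (length (drop i p) + length q + 1 + length (take i p)) s"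
      using assms n True by simp
    from shuffle_sum_multiadditive_left [OF this] True show ?thesis
      by (simp add: shuffle_sum_commute [of s "take i p"])
  next
    case False
    then obtain j where j: "i = Suc (length p + j)"
      by (metis add_Suc_right less_imp_Suc_add not_le)
    have "length p + length (take j q) + 1 + length (drop j q) = n"
      using n by simp
    with assms have "multiadditive (length p + length (take j q) + 1 + length (drop j q)) s"
      by simp
    from shuffle_sum_multiadditive_left [OF this] j show ?thesis
      by simp
  qed
qed

lemma poly_monom_induct [case_names monom add]:
  fixes p :: "'a :: comm_monoid_add poly"
  assumes "\<And>a i. P (monom a i)" and "\<And>p q. P p \<Longrightarrow> P q \<Longrightarrow> P (p + q)"
  shows "P p"
proof -
  have "P (\<Sum>i \<in> I. monom (coeff p i) i)" if "finite I" for I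
    using that
  proof induction
    case empty
    show ?case
      using assms(1) [of 0 0] by simp
  qed (use assms in simp)
  from this [of "{..degree p}"] show ?thesis
    by (simp add: poly_as_sum_of_monoms)
qed

text \<open>This map of letters, \<open>k \<cdot> 1\<^sub>i \<mapsto> k x\<^sup>i\<close>, is the homomorphism from \<open>ZN\<close> to \<open>Zx\<close> along
  which cochains are pulled back.\<close>

definition monomial_letter :: "nat \<times> int \<Rightarrow> unit \<times> int poly"
  where "monomial_letter u = ((), monom (snd u) (fst u))"

text \<open>The letters are replaced by sums of monomials one after the other, from the last to the first.\<close>

lemma multiadditive_eq_0:
  fixes s :: "(unit \<times> int poly) list \<Rightarrow> 'b :: comm_monoid_add"
  assumes add: "multiadditive n s" and monom: "\<And>w. length w = n \<Longrightarrow> s (map monomial_letter w) = 0"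
    and "length w = n"
  shows "s w = 0"
proof -
  have "s (p @ map monomial_letter q) = 0" if "length p + length q = n" for p q
    using that
  proof (induction p arbitrary: q rule: rev_induct)
    case Nil
    then show ?case
      using monom by simp
  next
    case (snoc l p)
    have "s (p @ ((), a) # map monomial_letter q) = 0" for a
    proof (induction a rule: poly_monom_induct)
      case (monom k i)
      show ?case
        using snoc.IH [of "(i, k) # q"] snoc.prems by (simp add: monomial_letter_def)
    next
      case (add a b)
      then show ?case
        using multiadditiveD [OF assms(1), of p "map monomial_letter q"] snoc.prems by simp
    qed
    then show ?case
      by (cases l) simp
  qed
  from this [of w "[]"] assms(3) show ?thesis
    by simp
qed

lemma additive_scale_bit:
  fixes f :: "'a :: comm_ring_1 \<Rightarrow> bit"
  assumes "\<And>a b. f (a + b) = f a + f b"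
  shows "f (of_int k * a) = of_int k * f a"
proof -
  have zero: "f 0 = 0"
    using assms [of 0 0] by simp
  then have minus: "f (- b) = f b" for b
    using assms [of b "- b"] by (simp add: bit_add_eq_0_iff)
  have nat: "f (of_nat n * a) = of_nat n * f a" for n
    by (induction n) (simp_all add: zero assms distrib_right)
  show ?thesis
    by (cases k rule: int_cases2) (simp_all add: nat minus)
qed

lemma multiadditive_scale:
  fixes s :: "('x \<times> 'a :: comm_ring_1) list \<Rightarrow> bit"
  assumes "multiadditive n s" and "length p + length q + 1 = n"
  shows "s (p @ (x, of_int k * a) # q) = of_int k * s (p @ (x, a) # q)"
  by (rule additive_scale_bit) (rule multiadditiveD [OF assms])

section \<open>Shuffle permutations\<close>

lemma sorted_wrt_filter_iff:
  "sorted_wrt (\<lambda>a b. P a \<and> P b \<longrightarrow> R a b) l \<longleftrightarrow> sorted_wrt R (filter P l)"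
  by (induction l) auto

text \<open>A shuffle permutation is encoded by the list of the original positions of the letters, in the order
  of the shuffled word.\<close>

definition arrangement :: "nat \<Rightarrow> (nat \<Rightarrow> nat) \<Rightarrow> nat list"
  where "arrangement n \<sigma> = map (inv_into UNIV \<sigma>) [0..<n]"

lemma permute_word_arrangement: "permute_word \<sigma> w = map ((!) w) (arrangement (length w) \<sigma>)"
  by (simp add: permute_word_def permute_list_def arrangement_def)

lemma arrangement_nth:
  assumes "\<sigma> permutes {..<n}" and "a < n"
  shows "\<sigma> a < n" and "arrangement n \<sigma> ! \<sigma> a = a"
  using permutes_in_image [OF assms(1), of a] permutes_inverses(2) [OF assms(1), of a] assms(2)
  by (simp_all add: arrangement_def)

lemma set_arrangement: "\<sigma> permutes {..<n} \<Longrightarrow> set (arrangement n \<sigma>) = {..<n}"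
  using permutes_image [OF permutes_inv, of \<sigma> "{..<n}"]
  by (simp add: arrangement_def atLeast0LessThan)

lemma distinct_arrangement: "\<sigma> permutes {..<n} \<Longrightarrow> distinct (arrangement n \<sigma>)"
  using permutes_inj_on [OF permutes_inv, of \<sigma> "{..<n}" "{..<n}"]
  by (simp add: arrangement_def distinct_map atLeast0LessThan)

lemma inj_on_arrangement: "inj_on (arrangement n) {\<sigma>. \<sigma> permutes {..<n}}"
proof (rule inj_onI)
  fix \<sigma> \<tau>
  assume perm: "\<sigma> \<in> {\<sigma>. \<sigma> permutes {..<n}}" "\<tau> \<in> {\<sigma>. \<sigma> permutes {..<n}}"
    and eq: "arrangement n \<sigma> = arrangement n \<tau>"
  have "\<sigma> a = \<tau> a" for a
  proof (cases "a < n")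
    case True
    have "\<sigma> a < length (arrangement n \<sigma>)" "\<tau> a < length (arrangement n \<sigma>)"
      using perm True arrangement_nth(1) [of _ n a] by (simp_all add: arrangement_def)
    moreover have "arrangement n \<sigma> ! \<sigma> a = arrangement n \<sigma> ! \<tau> a"
      using perm True arrangement_nth(2) [of _ n a] by (simp add: eq) (simp flip: eq)
    ultimately show ?thesis
      using distinct_arrangement [of \<sigma> n] perm by (simp add: nth_eq_iff_index_eq)
  next
    case False
    then show ?thesis
      using perm by (simp add: permutes_def)
  qed
  then show "\<sigma> = \<tau>"
    by blast
qed

lemma arrangement_surj:
  assumes "distinct l" and "set l = {..<n}"
  obtains \<sigma> where "\<sigma> permutes {..<n}" and "arrangement n \<sigma> = l"
proof -
  have len: "length l = n"
    using distinct_card [OF assms(1)] assms(2) by simp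
  define \<tau> where "\<tau> p = (if p < n then l ! p else p)" for p
  have "bij_betw \<tau> {..<n} {..<n}"
    using assms len by (simp add: bij_betw_def inj_on_def \<tau>_def nth_eq_iff_index_eq set_conv_nth)
      (auto simp: image_def)
  then have \<tau>: "\<tau> permutes {..<n}"
    by (rule bij_imp_permutes) (simp add: \<tau>_def)
  have "arrangement n (inv_into UNIV \<tau>) = map \<tau> [0..<n]"
    by (simp add: arrangement_def permutes_inv_inv [OF \<tau>])
  also have "\<dots> = l"
    by (rule nth_equalityI) (simp_all add: len \<tau>_def)
  finally show thesis
    using permutes_inv [OF \<tau>] by (intro that)
qed

lemma permutes_strict_mono_iff_filter_arrangement:
  assumes "\<sigma> permutes {..<n}" and "I \<subseteq> {..<n}"
  shows "strict_mono_on I \<sigma> \<longleftrightarrow> filter (\<lambda>a. a \<in> I) (arrangement n \<sigma>) = sorted_list_of_set I"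
proof -
  let ?l = "arrangement n \<sigma>"
  have fin: "finite I"
    using assms(2) finite_subset by blast
  have "strict_mono_on I \<sigma> \<longleftrightarrow> sorted_wrt (\<lambda>a b. a \<in> I \<and> b \<in> I \<longrightarrow> a < b) ?l"
  proof
    assume mono: "strict_mono_on I \<sigma>"
    show "sorted_wrt (\<lambda>a b. a \<in> I \<and> b \<in> I \<longrightarrow> a < b) ?l"
      unfolding sorted_wrt_iff_nth_less
    proof (intro allI impI, elim conjE)
      fix p q
      assume pq: "p < q" "q < length ?l" "?l ! p \<in> I" "?l ! q \<in> I"
      have "\<sigma> (?l ! p) = p" "\<sigma> (?l ! q) = q"
        using pq permutes_inverses(1) [OF assms(1)] by (simp_all add: arrangement_def)
      then show "?l ! p < ?l ! q"
        using strict_mono_onD [OF mono, of "?l ! q" "?l ! p"] pq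
        by (metis linorder_neqE_nat order_less_asym)
    qed
  next
    assume sorted: "sorted_wrt (\<lambda>a b. a \<in> I \<and> b \<in> I \<longrightarrow> a < b) ?l"
    show "strict_mono_on I \<sigma>"
    proof (rule strict_mono_onI)
      fix a b
      assume ab: "a \<in> I" "b \<in> I" "a < b"
      then have nth: "\<sigma> a < n" "?l ! \<sigma> a = a" "\<sigma> b < n" "?l ! \<sigma> b = b"
        using assms arrangement_nth by (auto simp: subset_iff)
      show "\<sigma> a < \<sigma> b"
      proof (rule ccontr)
        assume "\<not> \<sigma> a < \<sigma> b"
        moreover have "\<sigma> a \<noteq> \<sigma> b"
          using nth ab by auto
        ultimately show False
          using sorted_wrt_nth_less [OF sorted, of "\<sigma> b" "\<sigma> a"] nth ab
          by (simp add: arrangement_def)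
      qed
    qed
  qed
  also have "\<dots> \<longleftrightarrow> sorted_wrt (<) (filter (\<lambda>a. a \<in> I) ?l)"
    by (rule sorted_wrt_filter_iff)
  also have "\<dots> \<longleftrightarrow> filter (\<lambda>a. a \<in> I) ?l = sorted_list_of_set I"
  proof
    assume sorted: "sorted_wrt (<) (filter (\<lambda>a. a \<in> I) ?l)"
    moreover have "set (filter (\<lambda>a. a \<in> I) ?l) = I"
      using set_arrangement [OF assms(1)] assms(2) by auto
    ultimately show "filter (\<lambda>a. a \<in> I) ?l = sorted_list_of_set I"
      using fin by (metis sorted_list_of_set.idem_if_sorted_distinct strict_sorted_iff)
  next
    assume "filter (\<lambda>a. a \<in> I) ?l = sorted_list_of_set I"
    then show "sorted_wrt (<) (filter (\<lambda>a. a \<in> I) ?l)"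
      by (simp add: fin)
  qed
  finally show ?thesis .
qed

lemma bij_betw_arrangement_two_shuffles:
  "bij_betw (arrangement (i + j)) (two_shuffles i j) (shuffles [0..<i] [i..<i + j])"
proof (rule bij_betw_imageI)
  let ?n = "i + j"
  show "inj_on (arrangement ?n) (two_shuffles i j)"
    using inj_on_arrangement by (rule inj_on_subset) (auto simp: two_shuffles_def)
  have mono_iff: "strict_mono_on {..<i} \<sigma> \<and> strict_mono_on {i..<?n} \<sigma> \<longleftrightarrow>
      arrangement ?n \<sigma> \<in> shuffles [0..<i] [i..<?n]" if \<sigma>: "\<sigma> permutes {..<?n}" for \<sigma>
  proof -
    let ?l = "arrangement ?n \<sigma>"
    have upper: "filter (\<lambda>a. a \<in> {i..<?n}) ?l = filter (\<lambda>a. \<not> a \<in> {..<i}) ?l"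
      using set_arrangement [OF \<sigma>] by (intro filter_cong [OF refl]) (simp add: not_less)
    have "strict_mono_on {..<i} \<sigma> \<and> strict_mono_on {i..<?n} \<sigma> \<longleftrightarrow>
        filter (\<lambda>a. a \<in> {..<i}) ?l = [0..<i] \<and> filter (\<lambda>a. \<not> a \<in> {..<i}) ?l = [i..<?n]"
      using permutes_strict_mono_iff_filter_arrangement [OF \<sigma>, of "{..<i}"]
        permutes_strict_mono_iff_filter_arrangement [OF \<sigma>, of "{i..<?n}"]
      by (simp only: upper) (simp add: lessThan_atLeast0 subset_iff)
    also have "\<dots> \<longleftrightarrow> ?l \<in> shuffles [0..<i] [i..<?n]"
    proof
      assume "filter (\<lambda>a. a \<in> {..<i}) ?l = [0..<i] \<and> filter (\<lambda>a. \<not> a \<in> {..<i}) ?l = [i..<?n]"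
      then show "?l \<in> shuffles [0..<i] [i..<?n]"
        using partition_in_shuffles [of ?l "\<lambda>a. a \<in> {..<i}"] by simp
    next
      assume "?l \<in> shuffles [0..<i] [i..<?n]"
      from filter_shuffles_disjoint1 [OF _ this]
      show "filter (\<lambda>a. a \<in> {..<i}) ?l = [0..<i] \<and> filter (\<lambda>a. \<not> a \<in> {..<i}) ?l = [i..<?n]"
        by (simp add: atLeast0LessThan disjoint_iff)
    qed
    finally show ?thesis .
  qed
  show "arrangement ?n ` two_shuffles i j = shuffles [0..<i] [i..<?n]"
  proof (intro equalityI subsetI)
    fix l
    assume l: "l \<in> shuffles [0..<i] [i..<?n]"
    have "distinct l"
      using l by (rule distinct_disjoint_shuffles [rotated 3]) auto
    moreover have "set l = {..<?n}"
      by (simp add: set_shuffles [OF l] atLeast0LessThan ivl_disj_un_one(2))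
    ultimately obtain \<sigma> where "\<sigma> permutes {..<?n}" "arrangement ?n \<sigma> = l"
      by (rule arrangement_surj)
    then show "l \<in> arrangement ?n ` two_shuffles i j"
      using l mono_iff [of \<sigma>] by (auto simp: two_shuffles_def)
  next
    fix l
    assume "l \<in> arrangement ?n ` two_shuffles i j"
    then obtain \<sigma> where "\<sigma> \<in> two_shuffles i j" "l = arrangement ?n \<sigma>"
      by blast
    then show "l \<in> shuffles [0..<i] [i..<?n]"
      using mono_iff [of \<sigma>] by (simp add: two_shuffles_def)
  qed
qed

lemma sum_two_shuffles:
  assumes "length w = i + j"
  shows "(\<Sum>\<sigma> \<in> two_shuffles i j. s (permute_word \<sigma> w)) = shuffle_sum s (take i w) (drop i w)"
proof -
  have "(\<Sum>\<sigma> \<in> two_shuffles i j. s (permute_word \<sigma> w)) =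
      (\<Sum>l \<in> shuffles [0..<i] [i..<i + j]. s (map ((!) w) l))"
    using sum.reindex_bij_betw [OF bij_betw_arrangement_two_shuffles, of "\<lambda>l. s (map ((!) w) l)" i j]
    by (simp add: permute_word_arrangement assms)
  also have "\<dots> = shuffle_sum (\<lambda>l. s (map ((!) w) l)) [0..<i] [i..<i + j]"
    by (rule shuffle_sum_eq_sum_shuffles [symmetric]) auto
  also have "\<dots> = shuffle_sum s (map ((!) w) [0..<i]) (map ((!) w) [i..<i + j])"
    by (rule shuffle_sum_map)
  also have "map ((!) w) [0..<i] = take i w"
    using assms by (intro nth_equalityI) simp_all
  also have "map ((!) w) [i..<i + j] = drop i w"
    using assms by (intro nth_equalityI) simp_all
  finally show ?thesis .
qed

lemma Collect_insert_conv_if: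
  "{x \<in> insert a A. P x} = (if P a then insert a {x \<in> A. P x} else {x \<in> A. P x})"
  by auto

text \<open>Of the three terms of \<open>\<gamma>\<^sub>2[u|v]\<close>, two are equal to \<open>[u|u|v|v]\<close> and cancel modulo 2.\<close>

lemma sum_ordered_block_shuffles_2_2:
  fixes s :: "'l list \<Rightarrow> bit"
  shows "(\<Sum>\<sigma> \<in> ordered_block_shuffles 2 2. s (permute_word \<sigma> [u, v, u, v])) = s [u, v, u, v]"
proof -
  let ?S = "{l \<in> shuffles [0, 1] [2, 3]. filter (\<lambda>a. a \<in> {0, 2}) l = [0, 2::nat]}"
  have all: "shuffles [0, 1] [2, 3 :: nat] = {[0, 1, 2, 3], [0, 2, 1, 3], [0, 2, 3, 1],
      [2, 0, 1, 3], [2, 0, 3, 1], [2, 3, 0, 1]}"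
    by (auto simp: insert_commute)
  have S: "?S = {[0, 1, 2, 3], [0, 2, 1, 3], [0, 2, 3, 1]}"
    unfolding all Collect_insert_conv_if by simp
  have two: "two_shuffles 2 2 = {\<sigma>. \<sigma> permutes {..<4} \<and>
      strict_mono_on {..<2} \<sigma> \<and> strict_mono_on {2..<4} \<sigma>}"
    by (simp add: two_shuffles_def)
  have blocks: "(\<forall>b < 2. P b) \<longleftrightarrow> P 0 \<and> P 1" for P :: "nat \<Rightarrow> bool"
    by (auto dest: less_2_cases)
  have pairs: "(\<forall>b c. b < c \<and> c < 2 \<longrightarrow> P b c) \<longleftrightarrow> P 0 1" for P :: "nat \<Rightarrow> nat \<Rightarrow> bool"
    by (auto dest: less_2_cases)
  have "ordered_block_shuffles 2 2 = {\<sigma> \<in> two_shuffles 2 2. \<sigma> 0 < \<sigma> 2}"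
    unfolding two ordered_block_shuffles_def blocks pairs by (simp add: lessThan_atLeast0 conj_assoc)
  also have "\<dots> = {\<sigma> \<in> two_shuffles 2 2. filter (\<lambda>a. a \<in> {0, 2}) (arrangement 4 \<sigma>) = [0, 2]}"
  proof (rule Collect_cong, rule conj_cong [OF refl])
    fix \<sigma> :: "nat \<Rightarrow> nat"
    assume "\<sigma> \<in> two_shuffles 2 2"
    then have "\<sigma> permutes {..<4}"
      by (simp add: two)
    from permutes_strict_mono_iff_filter_arrangement [OF this, of "{0, 2}"]
    have "strict_mono_on {0, 2} \<sigma> \<longleftrightarrow> filter (\<lambda>a. a \<in> {0, 2}) (arrangement 4 \<sigma>) = [0, 2]"
      by simp
    then show "\<sigma> 0 < \<sigma> 2 \<longleftrightarrow> filter (\<lambda>a. a \<in> {0, 2}) (arrangement 4 \<sigma>) = [0, 2]"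
      by (simp only: strict_mono_on_def) auto
  qed
  finally have obs: "ordered_block_shuffles 2 2 = \<dots>" .
  have "[0..<2] = [0, 1]" "[2..<2 + 2] = [2, 3 :: nat]"
    by (simp_all add: numeral_2_eq_2)
  then have bij: "bij_betw (arrangement 4) (two_shuffles 2 2) (shuffles [0, 1] [2, 3])"
    using bij_betw_arrangement_two_shuffles [of 2 2] by simp
  have image: "f ` {x \<in> A. Q (f x)} = {y \<in> f ` A. Q y}" for f :: "(nat \<Rightarrow> nat) \<Rightarrow> nat list" and A Q
    by blast
  have "bij_betw (arrangement 4) (ordered_block_shuffles 2 2) ?S"
    unfolding obs
    by (rule bij_betw_subset [OF bij], blast)
      (simp only: image [where Q = "\<lambda>l. filter (\<lambda>a. a \<in> {0, 2}) l = [0, 2]"] bij_betw_imp_surj_on [OF bij])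
  note bij' = this [unfolded S]
  from sum.reindex_bij_betw [OF bij', of "\<lambda>l. s (map ((!) [u, v, u, v]) l)"]
  moreover have "permute_word \<sigma> [u, v, u, v] = map ((!) [u, v, u, v]) (arrangement 4 \<sigma>)" for \<sigma>
    using permute_word_arrangement [of \<sigma> "[u, v, u, v]"] by (simp add: eval_nat_numeral)
  ultimately show ?thesis
    by (simp add: add.commute)
qed

section \<open>Cochains with coefficients in the field with two elements\<close>

lemma class_module_simps [simp]:
  "carrier class_module = UNIV" "add class_module = (+)" "zero class_module = 0"
  "smult class_module k a = of_int k * a"
  by (simp_all add: class_module_def)

lemma abelian_group_class_module: "abelian_group (class_module :: (int, 'b :: comm_ring_1) module)"
  using module_class_module by (rule Module.module.axioms)

lemma finsum_class_module: "finsum (class_module :: (int, 'b :: comm_ring_1) module) f I = sum f I"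
proof -
  interpret abelian_group "class_module :: (int, 'b) module"
    by (rule abelian_group_class_module)
  show ?thesis
    by (induction I rule: infinite_finite_induct) (simp_all add: finsum_infinite)
qed

lemma add_pow_sign_bit:
  assumes "\<bar>k\<bar> = (1 :: int)"
  shows "add_pow class_module k v = (v :: bit)"
proof -
  interpret abelian_group "class_module :: (int, bit) module"
    by (rule abelian_group_class_module)
  have one: "add_pow class_module (1 :: nat) v = v"
    by (simp add: add_pow_def nat_pow_def)
  have "\<ominus>\<^bsub>class_module\<^esub> v = v"
    by (rule minus_equality) simp_all
  then show ?thesis
    using assms one by (cases "k \<ge> 0") (auto simp: add_pow_int_ge add_pow_int_lt)
qed

definition harrison :: "nat \<Rightarrow> ('l list \<Rightarrow> bit) \<Rightarrow> bool"
  where "harrison n s \<longleftrightarrow>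
    (\<forall>u v. u \<noteq> [] \<and> v \<noteq> [] \<and> length u + length v = n \<longrightarrow> shuffle_sum s u v = 0)"

lemma harrisonD:
  "harrison n s \<Longrightarrow> u \<noteq> [] \<Longrightarrow> v \<noteq> [] \<Longrightarrow> length u + length v = n \<Longrightarrow> shuffle_sum s u v = 0"
  by (simp add: harrison_def)

lemma no_even_blocks_5: "\<not> (2 \<le> k \<and> 2 \<le> m \<and> even m \<and> k * m = (5 :: nat))"
  by (metis dvd_mult odd_numeral)

lemma even_blocks_4: "2 \<le> k \<and> 2 \<le> m \<and> even m \<and> k * m = (4 :: nat) \<longleftrightarrow> k = 2 \<and> m = 2"
proof
  assume km: "2 \<le> k \<and> 2 \<le> m \<and> even m \<and> k * m = 4"
  have "k \<le> 2"
  proof (rule ccontr)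
    assume "\<not> k \<le> 2"
    then have "3 * 2 \<le> k * m"
      using km by (intro mult_mono) simp_all
    then show False
      using km by simp
  qed
  then have "k = 2"
    using km by simp
  then show "k = 2 \<and> m = 2"
    using km by simp
qed simp

text \<open>The algebras \<open>ZN\<close> and \<open>Zx\<close> with their modules, at once. Every word has its target in the two-element
  group, on which all the signs in the definitions act as the identity.\<close>

locale bit_coefficients = graded_module X \<Z> A M
  for X :: "'x monoid" and A :: "('x, int, 'a :: comm_ring_1) graded_alg"
    and M :: "('x, int, 'a, bit) graded_mod" +
  assumes carrier_X [simp]: "carrier X = UNIV"
    and alg_comp [simp]: "alg_comp A x = class_module"
    and mod_comp [simp]: "mod_comp M x = class_module"
begin

lemma words_eq: "words X A n = {w. length w = n}"
  by (auto simp: words_def)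

lemma hochschild_cochains_eq:
  "hochschild_cochains X \<Z> A M n = {s \<in> extensional {w. length w = n}. multiadditive n s}"
proof -
  have scale: "s (p @ (x, of_int k * a) # q) = of_int k * s (p @ (x, a) # q)"
    if "multiadditive n s" "length (p @ (x, a) # q) = n" for s :: "('x \<times> 'a) list \<Rightarrow> bit" and p x k a q
    using that by (intro multiadditive_scale) simp_all
  show ?thesis
  proof (intro Set.set_eqI iffI)
    fix s :: "('x \<times> 'a) list \<Rightarrow> bit"
    assume "s \<in> {s \<in> extensional {w. length w = n}. multiadditive n s}"
    then show "s \<in> hochschild_cochains X \<Z> A M n"
      by (simp add: hochschild_cochains_def words_eq PiE_def scale) (simp add: multiadditive_def)
  qed (simp add: hochschild_cochains_def words_eq PiE_def multiadditive_def)
qed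

lemma hochschild_diff_extensional: "hochschild_diff X A M n s \<in> extensional {w. length w = Suc n}"
  by (simp add: hochschild_diff_def words_eq)

lemma hochschild_diff_eq:
  assumes "length w = Suc n"
  shows "hochschild_diff X A M n s w =
    letter_act X M (hd w) (tl w) (s (tl w)) + (\<Sum>i = 1..n. s (merge X A i w)) +
    letter_act X M (last w) (butlast w) (s (butlast w))"
  using assms by (simp add: hochschild_diff_def words_eq finsum_class_module add_pow_sign_bit)

lemma signed_sum_eq: "signed_sum X M s S w = (\<Sum>\<sigma> \<in> S. s (permute_word \<sigma> w))"
  by (simp add: signed_sum_def finsum_class_module add_pow_sign_bit)

lemma harrison_iff:
  "(\<forall>i j. 1 \<le> i \<and> 1 \<le> j \<and> i + j = n \<longrightarrow>
      (\<forall>w \<in> words X A n. signed_sum X M s (two_shuffles i j) w = \<zero>\<^bsub>target X M w\<^esub>)) \<longleftrightarrow>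
    harrison n s" (is "?L \<longleftrightarrow> _")
proof -
  have sum: "signed_sum X M s (two_shuffles i j) w = shuffle_sum s (take i w) (drop i w)"
    if "length w = i + j" for w i j
    using that by (simp add: signed_sum_eq sum_two_shuffles)
  show ?thesis
  proof
    assume ?L
    then show "harrison n s"
      unfolding harrison_def
    proof (intro allI impI, elim conjE)
      fix u v :: "('x \<times> 'a) list"
      assume L: ?L and uv: "u \<noteq> []" "v \<noteq> []" "length u + length v = n"
      then have "signed_sum X M s (two_shuffles (length u) (length v)) (u @ v) = 0"
        by (simp add: words_eq Suc_le_eq)
      then show "shuffle_sum s u v = 0"
        by (simp add: sum)
    qed
  next
    assume "harrison n s"
    show ?L
    proof (intro allI impI ballI, elim conjE)
      fix i j w
      assume ij: "1 \<le> i" "1 \<le> j" "i + j = n" and w: "w \<in> words X A n"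
      then have "take i w \<noteq> []" "drop i w \<noteq> []" "length (take i w) + length (drop i w) = n"
        by (auto simp: words_eq)
      with \<open>harrison n s\<close> have "shuffle_sum s (take i w) (drop i w) = 0"
        unfolding harrison_def by blast
      then show "signed_sum X M s (two_shuffles i j) w = \<zero>\<^bsub>target X M w\<^esub>"
        using ij w by (simp add: sum words_eq)
    qed
  qed
qed

lemma barr_cochains_5:
  "s \<in> barr_cochains X \<Z> A M 5 \<longleftrightarrow> s \<in> hochschild_cochains X \<Z> A M 5 \<and> harrison 5 s"
  unfolding barr_cochains_def harrison_iff using no_even_blocks_5 by blast

lemma barr_cochains_4:
  "s \<in> barr_cochains X \<Z> A M 4 \<longleftrightarrow>
    s \<in> hochschild_cochains X \<Z> A M 4 \<and> harrison 4 s \<and> (\<forall>a b. s [a, b, a, b] = 0)"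
proof -
  have "(\<forall>k m. 2 \<le> k \<and> 2 \<le> m \<and> even m \<and> k * m = 4 \<longrightarrow> (\<forall>v \<in> words X A m.
      signed_sum X M s (ordered_block_shuffles k m) (concat (replicate k v)) =
      \<zero>\<^bsub>target X M (concat (replicate k v))\<^esub>)) \<longleftrightarrow>
    (\<forall>v \<in> words X A 2. signed_sum X M s (ordered_block_shuffles 2 2) (v @ v) = 0)"
    by (simp only: even_blocks_4) (simp add: numeral_2_eq_2)
  also have "\<dots> \<longleftrightarrow> (\<forall>a b. s [a, b, a, b] = 0)"
  proof -
    have "signed_sum X M s (ordered_block_shuffles 2 2) ([a, b] @ [a, b]) = s [a, b, a, b]" for a b
      by (simp add: signed_sum_eq sum_ordered_block_shuffles_2_2)
    moreover have pairs: "words X A 2 = {[a, b] | a b. True}"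
      by (auto simp: words_eq length_Suc_conv numeral_2_eq_2)
    have "(\<forall>v \<in> words X A 2. P v) \<longleftrightarrow> (\<forall>a b. P [a, b])" for P
      unfolding pairs by blast
    ultimately show ?thesis
      by (simp only:)
  qed
  finally show ?thesis
    unfolding barr_cochains_def harrison_iff by auto
qed

lemma word_functions_simps:
  "\<one>\<^bsub>word_functions X A M n\<^esub> = (\<lambda>w \<in> {w. length w = n}. 0)"
  "s \<otimes>\<^bsub>word_functions X A M n\<^esub> t = (\<lambda>w \<in> {w. length w = n}. s w + t w)"
  by (simp_all add: word_functions_def product_group_def words_eq)

lemma barr_cocycles_iff:
  "s \<in> barr_cocycles X \<Z> A M n \<longleftrightarrow>
    s \<in> barr_cochains X \<Z> A M n \<and> (\<forall>w. length w = Suc n \<longrightarrow> hochschild_diff X A M n s w = 0)"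
proof -
  have "hochschild_diff X A M n s = (\<lambda>w \<in> {w. length w = Suc n}. 0) \<longleftrightarrow>
      (\<forall>w. length w = Suc n \<longrightarrow> hochschild_diff X A M n s w = 0)"
    by (auto intro!: extensionalityI [OF hochschild_diff_extensional])
  then show ?thesis
    by (simp add: barr_cocycles_def word_functions_simps)
qed

lemma alg_mult_add:
  "alg_mult A x y (a + b) c = alg_mult A x y a c + alg_mult A x y b c"
  "alg_mult A x y c (a + b) = alg_mult A x y c a + alg_mult A x y c b"
  using alg_bilinear [of x y] by (simp_all add: bilinear_map_def)

lemma mod_act_add:
  "mod_act M y x (a + b) v = mod_act M y x a v + mod_act M y x b v"
  "mod_act M y x a (v + v') = mod_act M y x a v + mod_act M y x a v'"
  using act_bilinear [of y x] by (simp_all add: bilinear_map_def)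

definition letter_mult :: "'x \<times> 'a \<Rightarrow> 'x \<times> 'a \<Rightarrow> 'x \<times> 'a"
  where "letter_mult u v =
    (fst u \<otimes>\<^bsub>X\<^esub> fst v, alg_mult A (fst u) (fst v) (snd u) (snd v))"

lemma merge_append:
  "i = Suc (length p) \<Longrightarrow> merge X A i (p @ u # v # q) = p @ letter_mult u v # q"
  by (simp add: merge_def letter_mult_def nth_append split: prod.split)

lemma split_at_merge:
  assumes "1 \<le> i" and "i < length w"
  obtains p u v q where "w = p @ u # v # q" and "length p = i - 1"
proof
  show "w = take (i - 1) w @ w ! (i - 1) # w ! i # drop (Suc i) w"
    using assms Cons_nth_drop_Suc [of i w] id_take_nth_drop [of "i - 1" w] by simp
  show "length (take (i - 1) w) = i - 1"
    using assms by simp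
qed

lemma multiadditive_merge:
  assumes s: "multiadditive n s" and i: "1 \<le> i" "i \<le> n"
  shows "multiadditive (Suc n) (\<lambda>w. s (merge X A i w))"
  unfolding multiadditive_def
proof (intro allI impI)
  fix p q :: "('x \<times> 'a) list" and x a b
  assume len: "length p + length q + 1 = Suc n"
  consider "i < length p" | "i = length p" | "i = Suc (length p)" | "Suc (length p) < i"
    by linarith
  then show "s (merge X A i (p @ (x, a + b) # q)) =
      s (merge X A i (p @ (x, a) # q)) + s (merge X A i (p @ (x, b) # q))"
  proof cases
    case 1
    with i obtain p1 u v p2 where "p = p1 @ u # v # p2" "length p1 = i - 1"
      by (elim split_at_merge)
    with i len show ?thesis
      using multiadditiveD [OF s, of "p1 @ letter_mult u v # p2" q] by (simp add: merge_append)
  next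
    case 2
    with i obtain p1 u where p: "p = p1 @ [u]"
      by (cases p rule: rev_cases) auto
    with 2 len show ?thesis
      using multiadditiveD [OF s, of p1 q] by (simp add: merge_append letter_mult_def alg_mult_add)
  next
    case 3
    with i len obtain v q1 where "q = v # q1"
      by (cases q) auto
    with 3 len show ?thesis
      using multiadditiveD [OF s, of p q1] by (simp add: merge_append letter_mult_def alg_mult_add)
  next
    case 4
    then have "1 \<le> i - length p - 1" "i - length p - 1 < length q"
      using i len by simp_all
    then obtain q1 u v q2 where "q = q1 @ u # v # q2" "length q1 = i - length p - 1 - 1"
      by (rule split_at_merge)
    with 4 len show ?thesis
      using multiadditiveD [OF s, of p "q1 @ letter_mult u v # q2"]
        merge_append [of i "p @ (x, _) # q1" u v q2] by simp
  qed
qed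

lemma multiadditive_hochschild_diff:
  assumes s: "multiadditive n s"
  shows "multiadditive (Suc n) (hochschild_diff X A M n s)"
proof -
  have first: "multiadditive (Suc n) (\<lambda>w. letter_act X M (hd w) (tl w) (s (tl w)))"
    unfolding multiadditive_def
  proof (intro allI impI)
    fix p q :: "('x \<times> 'a) list" and x a b
    assume "length p + length q + 1 = Suc n"
    then show "letter_act X M (hd (p @ (x, a + b) # q)) (tl (p @ (x, a + b) # q)) (s (tl (p @ (x, a + b) # q))) =
      letter_act X M (hd (p @ (x, a) # q)) (tl (p @ (x, a) # q)) (s (tl (p @ (x, a) # q))) +
      letter_act X M (hd (p @ (x, b) # q)) (tl (p @ (x, b) # q)) (s (tl (p @ (x, b) # q)))"
      by (cases p) (simp_all add: letter_act_def word_deg_def mod_act_add multiadditiveD [OF s])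
  qed
  have last: "multiadditive (Suc n) (\<lambda>w. letter_act X M (last w) (butlast w) (s (butlast w)))"
    unfolding multiadditive_def
  proof (intro allI impI)
    fix p q :: "('x \<times> 'a) list" and x a b
    assume "length p + length q + 1 = Suc n"
    then show "letter_act X M (last (p @ (x, a + b) # q)) (butlast (p @ (x, a + b) # q)) (s (butlast (p @ (x, a + b) # q))) =
      letter_act X M (last (p @ (x, a) # q)) (butlast (p @ (x, a) # q)) (s (butlast (p @ (x, a) # q))) +
      letter_act X M (last (p @ (x, b) # q)) (butlast (p @ (x, b) # q)) (s (butlast (p @ (x, b) # q)))"
      by (cases q rule: rev_cases)
        (simp_all add: letter_act_def word_deg_def mod_act_add multiadditiveD [OF s] butlast_append)
  qed
  have "multiadditive (Suc n) (\<lambda>w. letter_act X M (hd w) (tl w) (s (tl w)) +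
      (\<Sum>i = 1..n. s (merge X A i w)) + letter_act X M (last w) (butlast w) (s (butlast w)))"
    by (intro multiadditive_add multiadditive_sum multiadditive_merge first last s) simp_all
  then show ?thesis
    by (subst multiadditive_cong [OF hochschild_diff_eq])
qed

end

interpretation ZN: bit_coefficients nat_degrees ZN constant_F2
  by (intro bit_coefficients.intro graded_module_ZN bit_coefficients_axioms.intro)
    (simp_all add: ZN_def constant_F2_def)

interpretation Zx: bit_coefficients trivial_degrees Zx F2_over_Zx
  by (intro bit_coefficients.intro graded_module_Zx bit_coefficients_axioms.intro)
    (simp_all add: Zx_def F2_over_Zx_def singleton_group_def UNIV_unit)

section \<open>Restriction to monomials\<close>

lemma multiadditive_monomial_letters:
  assumes "multiadditive n s"
  shows "multiadditive n (\<lambda>w. s (map monomial_letter w))"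
  unfolding multiadditive_def
proof (intro allI impI)
  fix p q :: "(nat \<times> int) list" and x a b
  assume "length p + length q + 1 = n"
  then show "s (map monomial_letter (p @ (x, a + b) # q)) =
      s (map monomial_letter (p @ (x, a) # q)) + s (map monomial_letter (p @ (x, b) # q))"
    using multiadditiveD [OF assms, of "map monomial_letter p" "map monomial_letter q"]
    by (simp add: monomial_letter_def add_monom [symmetric])
qed

lemma multiadditive_eq:
  fixes s t :: "(unit \<times> int poly) list \<Rightarrow> bit"
  assumes "multiadditive n s" and "multiadditive n t"
    and "\<And>w. length w = n \<Longrightarrow> s (map monomial_letter w) = t (map monomial_letter w)"
    and "length w = n"
  shows "s w = t w"
proof -
  have "s w + t w = 0"
    by (rule multiadditive_eq_0 [OF multiadditive_add [OF assms(1,2)]]) (simp_all add: assms(3,4))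
  then show ?thesis
    by (simp add: bit_add_eq_0_iff)
qed

text \<open>The inverse of pulling back along \<^const>\<open>monomial_letter\<close>: the multilinear extension of a cochain of
  \<open>ZN\<close> to words of polynomials, one letter at a time.\<close>

fun expand :: "((nat \<times> int) list \<Rightarrow> bit) \<Rightarrow> (unit \<times> int poly) list \<Rightarrow> bit"
  where
    "expand f [] = f []"
  | "expand f (l # w) = (\<Sum>i \<le> degree (snd l). expand (\<lambda>v. f ((i, coeff (snd l) i) # v)) w)"

lemma expand_cong:
  "(\<And>v. length v = length w \<Longrightarrow> f v = g v) \<Longrightarrow> expand f w = expand g w"
  by (induction f w arbitrary: g rule: expand.induct) (auto intro!: sum.cong)

lemma expand_add: "expand (\<lambda>v. f v + g v) w = expand f w + expand g w"
proof (induction w arbitrary: f g)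
  case (Cons l w)
  show ?case
    by (simp add: Cons.IH sum.distrib)
qed simp

lemma expand_zero: "expand (\<lambda>v. 0) w = 0"
  by (induction w) simp_all

text \<open>Summing up to a common bound instead of the degree makes the sums for \<open>a\<close>, \<open>b\<close> and \<open>a + b\<close>
  comparable.\<close>

lemma expand_Cons_bound:
  assumes "multiadditive (Suc (length w)) f" and "degree a \<le> N"
  shows "expand f ((x, a) # w) = (\<Sum>i \<le> N. expand (\<lambda>v. f ((i, coeff a i) # v)) w)"
proof -
  have "expand (\<lambda>v. f ((i, coeff a i) # v)) w = 0" if "i \<notin> {..degree a}" for i
  proof -
    have "f ((i, 0) # v) = 0" if "length v = length w" for v
      using multiadditive_Cons_head [OF assms(1) that, of i 0 0] by simp
    then show ?thesis
      using that expand_cong [of w "\<lambda>v. f ((i, 0) # v)" "\<lambda>_. 0"] by (simp add: coeff_eq_0 expand_zero)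
  qed
  then show ?thesis
    using assms(2) by (simp, intro sum.mono_neutral_left) auto
qed

lemma multiadditive_expand:
  assumes "multiadditive n f"
  shows "multiadditive n (expand f)"
proof -
  have "expand f (p @ (x, a + b) # q) = expand f (p @ (x, a) # q) + expand f (p @ (x, b) # q)"
    if "multiadditive (length p + length q + 1) f" for p q x a b
    using that
  proof (induction p arbitrary: f)
    case Nil
    let ?N = "max (degree a) (degree b)"
    have f: "multiadditive (Suc (length q)) f"
      using Nil by simp
    have "expand (\<lambda>v. f ((i, coeff (a + b) i) # v)) q =
        expand (\<lambda>v. f ((i, coeff a i) # v) + f ((i, coeff b i) # v)) q" for i
      by (rule expand_cong) (simp add: multiadditive_Cons_head [OF f])
    moreover have "degree (a + b) \<le> ?N"
      by (rule degree_add_le_max)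
    ultimately show ?case
      by (simp only: append_Nil expand_Cons_bound [OF f, of _ ?N] expand_add sum.distrib max.cobounded1 max.cobounded2)
  next
    case (Cons l p)
    have "multiadditive (length p + length q + 1) (\<lambda>v. f (m # v))" for m
      using Cons.prems by (intro multiadditive_Cons) simp
    from Cons.IH [OF this] show ?case
      by (simp add: sum.distrib)
  qed
  then show ?thesis
    using assms by (auto simp: multiadditive_def)
qed

lemma expand_monomials: "multiadditive (length w) f \<Longrightarrow> expand f (map monomial_letter w) = f w"
proof (induction w arbitrary: f)
  case (Cons u w)
  obtain i k where u: "u = (i, k)"
    by (cases u)
  have "expand (\<lambda>v. f ((j, coeff (monom k i) j) # v)) (map monomial_letter w) =
      (if j = i then f (u # w) else 0)" for j
  proof -
    have "expand (\<lambda>v. f ((j, coeff (monom k i) j) # v)) (map monomial_letter w) = f ((j, coeff (monom k i) j) # w)"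
      using Cons.prems by (intro Cons.IH multiadditive_Cons) simp
    moreover have "f ((j, 0) # w) = 0"
      using multiadditive_Cons_head [of "length w" f w j 0 0] Cons.prems by simp
    ultimately show ?thesis
      by (simp add: u)
  qed
  moreover have "expand f (map monomial_letter (u # w)) =
      (\<Sum>j \<le> i. expand (\<lambda>v. f ((j, coeff (monom k i) j) # v)) (map monomial_letter w))"
    using expand_Cons_bound [of "map monomial_letter w" f "monom k i" i "()"] Cons.prems
    by (simp add: u monomial_letter_def degree_monom_le)
  ultimately show ?case
    by simp
qed simp

definition monomial_restriction ::
    "nat \<Rightarrow> ((unit \<times> int poly) list \<Rightarrow> bit) \<Rightarrow> (nat \<times> int) list \<Rightarrow> bit"
  where "monomial_restriction n s = (\<lambda>w \<in> {w. length w = n}. s (map monomial_letter w))"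

lemma monomial_restriction_apply:
  "length w = n \<Longrightarrow> monomial_restriction n s w = s (map monomial_letter w)"
  by (simp add: monomial_restriction_def)

lemma bij_betw_monomial_restriction:
  "bij_betw (monomial_restriction n)
    (hochschild_cochains trivial_degrees \<Z> Zx F2_over_Zx n) (hochschild_cochains nat_degrees \<Z> ZN constant_F2 n)"
  unfolding ZN.hochschild_cochains_eq Zx.hochschild_cochains_eq
proof (rule bij_betw_imageI)
  show "inj_on (monomial_restriction n) {s \<in> extensional {w. length w = n}. multiadditive n s}"
  proof (rule inj_onI)
    fix s t
    assume s: "s \<in> {s \<in> extensional {w. length w = n}. multiadditive n s}"
      and t: "t \<in> {s \<in> extensional {w. length w = n}. multiadditive n s}"
      and eq: "monomial_restriction n s = monomial_restriction n t"
    have "s (map monomial_letter w) = t (map monomial_letter w)" if "length w = n" for w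
      using fun_cong [OF eq, of w] that by (simp add: monomial_restriction_apply)
    then have "s w = t w" if "length w = n" for w
      using s t that by (auto intro: multiadditive_eq [of n s t])
    then show "s = t"
      using s t by (intro extensionalityI [of s "{w. length w = n}"]) simp_all
  qed
  show "monomial_restriction n ` {s \<in> extensional {w. length w = n}. multiadditive n s} =
      {f \<in> extensional {w. length w = n}. multiadditive n f}"
  proof (intro equalityI subsetI)
    fix f
    assume "f \<in> monomial_restriction n ` {s \<in> extensional {w. length w = n}. multiadditive n s}"
    then obtain s where s: "multiadditive n s" "f = monomial_restriction n s"
      by blast
    have "multiadditive n f"
      using multiadditive_monomial_letters [OF s(1)]
      by (simp add: s(2) monomial_restriction_apply cong: multiadditive_cong)
    then show "f \<in> {f \<in> extensional {w. length w = n}. multiadditive n f}"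
      by (simp add: s(2) monomial_restriction_def)
  next
    fix f :: "(nat \<times> int) list \<Rightarrow> bit"
    assume f: "f \<in> {f \<in> extensional {w. length w = n}. multiadditive n f}"
    define s where "s = (\<lambda>w \<in> {w. length w = n}. expand f w)"
    have "multiadditive n s"
      using multiadditive_expand [of n f] f by (simp add: s_def cong: multiadditive_cong)
    moreover have "monomial_restriction n s w = f w" if "length w = n" for w
      using f that expand_monomials [of w f] by (simp add: s_def monomial_restriction_apply)
    then have "f = monomial_restriction n s"
      using f by (intro extensionalityI [of f "{w. length w = n}"]) (simp_all add: monomial_restriction_def)
    moreover have "s \<in> extensional {w. length w = n}"
      by (simp add: s_def)
    ultimately show "f \<in> monomial_restriction n ` {s \<in> extensional {w. length w = n}. multiadditive n s}"
      by blast
  qed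
qed

lemma shuffle_sum_monomial_restriction:
  assumes "length u + length v = n"
  shows "shuffle_sum (monomial_restriction n s) u v =
    shuffle_sum s (map monomial_letter u) (map monomial_letter v)"
proof -
  have "shuffle_sum (monomial_restriction n s) u v = shuffle_sum (\<lambda>w. s (map monomial_letter w)) u v"
    using assms by (intro shuffle_sum_cong) (simp add: monomial_restriction_apply)
  then show ?thesis
    by (simp add: shuffle_sum_map)
qed

lemma harrison_monomial_restriction:
  assumes "multiadditive n s"
  shows "harrison n (monomial_restriction n s) \<longleftrightarrow> harrison n s"
proof
  assume "harrison n s"
  then show "harrison n (monomial_restriction n s)"
    by (simp add: harrison_def shuffle_sum_monomial_restriction)
next
  assume res: "harrison n (monomial_restriction n s)"
  show "harrison n s"
    unfolding harrison_def
  proof (intro allI impI, elim conjE)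
    fix u v :: "(unit \<times> int poly) list"
    assume uv: "u \<noteq> []" "v \<noteq> []" "length u + length v = n"
    let ?i = "length u"
    have "shuffle_sum s (take ?i (u @ v)) (drop ?i (u @ v)) = 0"
    proof (rule multiadditive_eq_0 [OF multiadditive_shuffle_sum [OF assms]])
      fix w :: "(nat \<times> int) list"
      assume w: "length w = n"
      have "take ?i w \<noteq> []" "drop ?i w \<noteq> []" "length (take ?i w) + length (drop ?i w) = n"
        using uv w by auto
      then have "shuffle_sum (monomial_restriction n s) (take ?i w) (drop ?i w) = 0"
        using res unfolding harrison_def by blast
      then show "shuffle_sum s (take ?i (map monomial_letter w)) (drop ?i (map monomial_letter w)) = 0"
        using w uv by (simp add: shuffle_sum_monomial_restriction take_map drop_map)
    qed (use uv in simp)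
    then show "shuffle_sum s u v = 0"
      by simp
  qed
qed

lemma merge_monomial_letters:
  assumes "1 \<le> i" and "i < length w"
  shows "merge trivial_degrees Zx i (map monomial_letter w) = map monomial_letter (merge nat_degrees ZN i w)"
proof -
  obtain p u v q where w: "w = p @ u # v # q" and p: "length p = i - 1"
    using assms by (rule ZN.split_at_merge)
  have "i = Suc (length p)" "i = Suc (length (map monomial_letter p))"
    using p assms by simp_all
  note merge = ZN.merge_append [OF this(1)] Zx.merge_append [OF this(2)]
  have "Zx.letter_mult (monomial_letter u) (monomial_letter v) = monomial_letter (ZN.letter_mult u v)"
    by (simp add: ZN.letter_mult_def Zx.letter_mult_def monomial_letter_def)
      (simp add: ZN_def Zx_def mult_monom)
  then show ?thesis
    by (simp add: w merge)
qed

lemma hochschild_diff_monomial_restriction: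
  "hochschild_diff nat_degrees ZN constant_F2 n (monomial_restriction n s) =
    monomial_restriction (Suc n) (hochschild_diff trivial_degrees Zx F2_over_Zx n s)"
proof (rule extensionalityI [OF ZN.hochschild_diff_extensional])
  fix w :: "(nat \<times> int) list"
  assume "w \<in> {w. length w = Suc n}"
  then have w: "length w = Suc n" "w \<noteq> []"
    by auto
  have act: "letter_act trivial_degrees F2_over_Zx (monomial_letter u) (map monomial_letter v) b =
      letter_act nat_degrees constant_F2 u v b" for u v b
    by (simp add: letter_act_def F2_over_Zx_def constant_F2_def monomial_letter_def poly_monom)
  have "length (merge nat_degrees ZN i w) = n" if "i \<in> {1..n}" for i
    using that w by (auto simp: merge_def min_def split: prod.split)
  then have "(\<Sum>i = 1..n. monomial_restriction n s (merge nat_degrees ZN i w)) =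
      (\<Sum>i = 1..n. s (merge trivial_degrees Zx i (map monomial_letter w)))"
    using w by (intro sum.cong) (simp_all add: monomial_restriction_apply merge_monomial_letters)
  then show "hochschild_diff nat_degrees ZN constant_F2 n (monomial_restriction n s) w =
      monomial_restriction (Suc n) (hochschild_diff trivial_degrees Zx F2_over_Zx n s) w"
    using w by (simp add: ZN.hochschild_diff_eq Zx.hochschild_diff_eq monomial_restriction_apply
        hd_map last_map map_tl [symmetric] map_butlast [symmetric] act)
qed (simp add: monomial_restriction_def)

section \<open>The isomorphism of Barr cohomology\<close>

text \<open>The set \<open>D\<close> is to be the group of all Hochschild cochains. Working in it, one only needs the images of the
  cocycles and of the coboundaries under a bijection of cochains.\<close>

lemma FactGroup_image_iso:
  assumes inj: "inj_on \<phi> D" and "carrier G \<subseteq> D" and "H \<subseteq> D"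
    and closed: "\<And>x y. x \<in> D \<Longrightarrow> y \<in> D \<Longrightarrow> x \<otimes>\<^bsub>G\<^esub> y \<in> D"
    and hom: "\<And>x y. x \<in> D \<Longrightarrow> y \<in> D \<Longrightarrow> \<phi> (x \<otimes>\<^bsub>G\<^esub> y) = \<phi> x \<otimes>\<^bsub>G'\<^esub> \<phi> y"
    and carrier: "\<phi> ` carrier G = carrier G'" and sub: "\<phi> ` H = H'"
  shows "(`) \<phi> \<in> iso (G Mod H) (G' Mod H')"
proof -
  have image_mult: "\<phi> ` (C <#>\<^bsub>G\<^esub> C') = \<phi> ` C <#>\<^bsub>G'\<^esub> \<phi> ` C'" if "C \<subseteq> D" "C' \<subseteq> D" for C C'
  proof -
    have "\<phi> ` (C <#>\<^bsub>G\<^esub> C') = (\<Union>h \<in> C. \<Union>k \<in> C'. {\<phi> (h \<otimes>\<^bsub>G\<^esub> k)})"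
      by (simp add: set_mult_def image_UN)
    also have "\<dots> = (\<Union>h \<in> C. \<Union>k \<in> C'. {\<phi> h \<otimes>\<^bsub>G'\<^esub> \<phi> k})"
      using that by (intro SUP_cong [OF refl]) (simp add: hom subsetD)
    finally show ?thesis
      by (simp add: set_mult_def)
  qed
  have coset: "\<phi> ` (H #>\<^bsub>G\<^esub> x) = H' #>\<^bsub>G'\<^esub> \<phi> x" if "x \<in> carrier G" for x
    unfolding r_coset_eq_set_mult using that assms(2,3) image_mult [of H "{x}"] by (simp add: sub subsetD)
  have cosets_D: "C \<subseteq> D" if "C \<in> carrier (G Mod H)" for C
  proof -
    obtain x where "x \<in> carrier G" "C = H #>\<^bsub>G\<^esub> x"
      using \<open>C \<in> carrier (G Mod H)\<close> by (auto simp: FactGroup_def RCOSETS_def)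
    then show ?thesis
      unfolding r_coset_def using assms(2,3) closed by blast
  qed
  have "(`) \<phi> ` carrier (G Mod H) = (\<lambda>x. H' #>\<^bsub>G'\<^esub> \<phi> x) ` carrier G"
    using coset by (simp add: FactGroup_def RCOSETS_def UNION_singleton_eq_range image_image)
  also have "\<dots> = carrier (G' Mod H')"
    unfolding FactGroup_def RCOSETS_def by (simp flip: carrier add: UNION_singleton_eq_range image_image)
  finally have "(`) \<phi> ` carrier (G Mod H) = carrier (G' Mod H')" .
  moreover have "inj_on ((`) \<phi>) (carrier (G Mod H))"
    by (rule inj_on_subset [OF inj_on_image_Pow [OF inj]]) (use cosets_D in blast)
  moreover have "\<phi> ` (C \<otimes>\<^bsub>G Mod H\<^esub> C') = \<phi> ` C \<otimes>\<^bsub>G' Mod H'\<^esub> \<phi> ` C'"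
    if "C \<in> carrier (G Mod H)" "C' \<in> carrier (G Mod H)" for C C'
    using image_mult [OF that [THEN cosets_D]] by (simp add: FactGroup_def)
  ultimately show ?thesis
    by (auto simp: iso_def hom_def bij_betw_def)
qed

lemma multiadditive_4:
  assumes "multiadditive 4 s"
  shows "s [(x, a + b), u, v, w] = s [(x, a), u, v, w] + s [(x, b), u, v, w]"
    and "s [u, (x, a + b), v, w] = s [u, (x, a), v, w] + s [u, (x, b), v, w]"
    and "s [u, v, (x, a + b), w] = s [u, v, (x, a), w] + s [u, v, (x, b), w]"
    and "s [u, v, w, (x, a + b)] = s [u, v, w, (x, a)] + s [u, v, w, (x, b)]"
  using multiadditiveD [OF assms, of "[]" "[u, v, w]"] multiadditiveD [OF assms, of "[u]" "[v, w]"]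
    multiadditiveD [OF assms, of "[u, v]" "[w]"] multiadditiveD [OF assms, of "[u, v, w]" "[]"]
  by simp_all

lemma harrison_4_2_2:
  assumes "harrison 4 s"
  shows "s [a, b, c, d] + s [a, c, b, d] + s [a, c, d, b] + s [c, a, b, d] + s [c, a, d, b] + s [c, d, a, b] = 0"
proof -
  have "shuffle_sum s [a, b] [c, d] = 0"
    by (rule harrisonD [OF assms]) simp_all
  then show ?thesis
    by (simp add: ac_simps)
qed

text \<open>The function \<open>p \<mapsto> s(p,b,p,b)\<close> is additive: its polarization is
  \<open>s(p,b,q,b) + s(q,b,p,b)\<close>, and this is the value of \<open>s\<close> on the shuffles of \<open>[p|b]\<close> and \<open>[q|b]\<close>, since
  the remaining four of them, two \<open>[p|q|b|b]\<close> and two \<open>[q|p|b|b]\<close>, cancel modulo 2. The same works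
  in the second variable.\<close>

lemma vanishes_on_squares:
  fixes s :: "(unit \<times> int poly) list \<Rightarrow> bit"
  assumes add: "multiadditive 4 s" and harrison: "harrison 4 s"
    and monomials: "\<And>u v. s [monomial_letter u, monomial_letter v, monomial_letter u, monomial_letter v] = 0"
  shows "s [a, b, a, b] = 0"
proof -
  have left: "s [((), p), b, ((), p), b] = 0"
    if "\<And>u. s [monomial_letter u, b, monomial_letter u, b] = 0" for p b
  proof (induction p rule: poly_monom_induct)
    case (monom k i)
    show ?case
      using that [of "(i, k)"] by (simp add: monomial_letter_def)
  next
    case (add p q)
    then show ?case
      using harrison_4_2_2 [OF harrison, of "((), p)" b "((), q)" b]
      by (simp add: multiadditive_4 [OF assms(1)] ac_simps)
  qed
  have right: "s [a, ((), p), a, ((), p)] = 0"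
    if "\<And>v. s [a, monomial_letter v, a, monomial_letter v] = 0" for p a
  proof (induction p rule: poly_monom_induct)
    case (monom k i)
    show ?case
      using that [of "(i, k)"] by (simp add: monomial_letter_def)
  next
    case (add p q)
    then show ?case
      using harrison_4_2_2 [OF harrison, of a "((), p)" a "((), q)"]
      by (simp add: multiadditive_4 [OF assms(1)] ac_simps)
  qed
  obtain p q where ab: "a = ((), p)" "b = ((), q)"
    by (cases a, cases b) auto
  have "s [a, monomial_letter v, a, monomial_letter v] = 0" for v
    unfolding ab using monomials by (rule left)
  then show ?thesis
    unfolding ab(2) by (rule right)
qed

lemma monomial_restriction_image:
  assumes "\<And>s. s \<in> hochschild_cochains trivial_degrees \<Z> Zx F2_over_Zx n \<Longrightarrow>
    monomial_restriction n s \<in> S' \<longleftrightarrow> s \<in> S"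
    and "S \<subseteq> hochschild_cochains trivial_degrees \<Z> Zx F2_over_Zx n"
    and "S' \<subseteq> hochschild_cochains nat_degrees \<Z> ZN constant_F2 n"
  shows "monomial_restriction n ` S = S'"
proof -
  have "S' \<subseteq> monomial_restriction n ` hochschild_cochains trivial_degrees \<Z> Zx F2_over_Zx n"
    using assms(3) bij_betw_imp_surj_on [OF bij_betw_monomial_restriction] by simp
  then show ?thesis
    using assms(1,2) by blast
qed

lemma multiadditive_hochschild_cochain:
  "s \<in> hochschild_cochains trivial_degrees \<Z> Zx F2_over_Zx n \<Longrightarrow> multiadditive n s"
  by (simp add: Zx.hochschild_cochains_eq)

lemma monomial_restriction_hochschild:
  "s \<in> hochschild_cochains trivial_degrees \<Z> Zx F2_over_Zx n \<Longrightarrow>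
    monomial_restriction n s \<in> hochschild_cochains nat_degrees \<Z> ZN constant_F2 n"
  using bij_betw_monomial_restriction by (rule bij_betwE [THEN bspec])

lemma image_barr_cochains_4:
  "monomial_restriction 4 ` barr_cochains trivial_degrees \<Z> Zx F2_over_Zx 4 =
    barr_cochains nat_degrees \<Z> ZN constant_F2 4"
proof (rule monomial_restriction_image)
  fix s
  assume s: "s \<in> hochschild_cochains trivial_degrees \<Z> Zx F2_over_Zx 4"
  have sq: "monomial_restriction 4 s [u, v, u, v] =
      s [monomial_letter u, monomial_letter v, monomial_letter u, monomial_letter v]" for u v
    by (simp add: monomial_restriction_apply)
  have "harrison 4 s \<Longrightarrow> (\<forall>u v. monomial_restriction 4 s [u, v, u, v] = 0) \<longleftrightarrow> (\<forall>a b. s [a, b, a, b] = 0)"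
    unfolding sq using vanishes_on_squares [OF multiadditive_hochschild_cochain [OF s]] by blast
  then show "monomial_restriction 4 s \<in> barr_cochains nat_degrees \<Z> ZN constant_F2 4 \<longleftrightarrow>
      s \<in> barr_cochains trivial_degrees \<Z> Zx F2_over_Zx 4"
    using s monomial_restriction_hochschild [OF s]
      harrison_monomial_restriction [OF multiadditive_hochschild_cochain [OF s]]
    by (simp only: ZN.barr_cochains_4 Zx.barr_cochains_4) blast
qed (auto simp: barr_cochains_def)

lemma image_barr_cocycles_5:
  "monomial_restriction 5 ` barr_cocycles trivial_degrees \<Z> Zx F2_over_Zx 5 =
    barr_cocycles nat_degrees \<Z> ZN constant_F2 5"
proof (rule monomial_restriction_image)
  fix s
  assume s: "s \<in> hochschild_cochains trivial_degrees \<Z> Zx F2_over_Zx 5"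
  let ?d = "hochschild_diff trivial_degrees Zx F2_over_Zx 5 s"
  note add = multiadditive_hochschild_cochain [OF s]
  have "(\<forall>w. length w = Suc 5 \<longrightarrow> monomial_restriction (Suc 5) ?d w = 0) \<longleftrightarrow>
      (\<forall>w. length w = Suc 5 \<longrightarrow> ?d w = 0)"
  proof (intro iffI allI impI)
    fix w :: "(unit \<times> int poly) list"
    assume zero: "\<forall>w. length w = Suc 5 \<longrightarrow> monomial_restriction (Suc 5) ?d w = 0" and w: "length w = Suc 5"
    show "?d w = 0"
    proof (rule multiadditive_eq_0 [OF Zx.multiadditive_hochschild_diff [OF add] _ w])
      fix v :: "(nat \<times> int) list"
      assume "length v = Suc 5"
      then show "?d (map monomial_letter v) = 0"
        using zero monomial_restriction_apply [of v "Suc 5" ?d] by simp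
    qed
  qed (simp add: monomial_restriction_apply)
  then show "monomial_restriction 5 s \<in> barr_cocycles nat_degrees \<Z> ZN constant_F2 5 \<longleftrightarrow>
      s \<in> barr_cocycles trivial_degrees \<Z> Zx F2_over_Zx 5"
    using s monomial_restriction_hochschild [OF s] harrison_monomial_restriction [OF add]
    by (simp only: ZN.barr_cocycles_iff Zx.barr_cocycles_iff ZN.barr_cochains_5 Zx.barr_cochains_5
        hochschild_diff_monomial_restriction)
qed (auto simp: barr_cocycles_def barr_cochains_def)

lemma image_barr_coboundaries_5:
  "monomial_restriction 5 ` barr_coboundaries trivial_degrees \<Z> Zx F2_over_Zx 5 =
    barr_coboundaries nat_degrees \<Z> ZN constant_F2 5"
proof -
  have "monomial_restriction (Suc 4) `
        hochschild_diff trivial_degrees Zx F2_over_Zx 4 ` barr_cochains trivial_degrees \<Z> Zx F2_over_Zx 4 =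
      hochschild_diff nat_degrees ZN constant_F2 4 `
        monomial_restriction 4 ` barr_cochains trivial_degrees \<Z> Zx F2_over_Zx 4"
    unfolding image_image hochschild_diff_monomial_restriction ..
  then show ?thesis
    by (simp add: barr_coboundaries_def image_barr_cochains_4)
qed

lemma barr_coboundaries_5_subset:
  "barr_coboundaries trivial_degrees \<Z> Zx F2_over_Zx 5 \<subseteq> hochschild_cochains trivial_degrees \<Z> Zx F2_over_Zx 5"
proof
  fix f
  assume "f \<in> barr_coboundaries trivial_degrees \<Z> Zx F2_over_Zx 5"
  then obtain s where s: "s \<in> barr_cochains trivial_degrees \<Z> Zx F2_over_Zx 4"
    and f: "f = hochschild_diff trivial_degrees Zx F2_over_Zx 4 s"
    by (auto simp: barr_coboundaries_def)
  have "multiadditive 4 s"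
    using s by (auto simp: barr_cochains_def intro: multiadditive_hochschild_cochain)
  then have "multiadditive (Suc 4) f"
    unfolding f by (rule Zx.multiadditive_hochschild_diff)
  moreover have "f \<in> extensional {w. length w = Suc 4}"
    unfolding f by (rule Zx.hochschild_diff_extensional)
  ultimately show "f \<in> hochschild_cochains trivial_degrees \<Z> Zx F2_over_Zx 5"
    by (simp add: Zx.hochschild_cochains_eq)
qed

lemma (in bit_coefficients) hochschild_cochains_mult_closed:
  assumes "s \<in> hochschild_cochains X \<Z> A M n" and "t \<in> hochschild_cochains X \<Z> A M n"
  shows "s \<otimes>\<^bsub>word_functions X A M n\<^esub> t \<in> hochschild_cochains X \<Z> A M n"
  using assms by (simp add: hochschild_cochains_eq word_functions_simps multiadditive_add cong: multiadditive_cong)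

lemma Barr_5_iso:
  "Barr nat_degrees \<Z> ZN constant_F2 5 \<cong> Barr trivial_degrees \<Z> Zx F2_over_Zx 5"
proof -
  let ?D = "hochschild_cochains trivial_degrees \<Z> Zx F2_over_Zx 5"
  let ?D' = "hochschild_cochains nat_degrees \<Z> ZN constant_F2 5"
  let ?r = "monomial_restriction 5"
  let ?e = "inv_into ?D ?r"
  let ?G = "(word_functions trivial_degrees Zx F2_over_Zx 5)
    \<lparr>carrier := barr_cocycles trivial_degrees \<Z> Zx F2_over_Zx 5\<rparr>"
  let ?G' = "(word_functions nat_degrees ZN constant_F2 5)\<lparr>carrier := barr_cocycles nat_degrees \<Z> ZN constant_F2 5\<rparr>"
  let ?H = "barr_coboundaries trivial_degrees \<Z> Zx F2_over_Zx 5"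
  let ?H' = "barr_coboundaries nat_degrees \<Z> ZN constant_F2 5"
  have bij: "bij_betw ?r ?D ?D'"
    by (rule bij_betw_monomial_restriction)
  have bij': "bij_betw ?e ?D' ?D"
    using bij by (rule bij_betw_inv_into)
  have e_image: "?e ` ?r ` S = S" if "S \<subseteq> ?D" for S
    using inv_into_image_cancel [OF bij_betw_imp_inj_on [OF bij] that] .
  have G: "carrier ?G \<subseteq> ?D"
    by (auto simp: barr_cocycles_def barr_cochains_def)
  have "(`) ?e \<in> iso (?G' Mod ?H') (?G Mod ?H)"
  proof (rule FactGroup_image_iso [where D = ?D'])
    show "inj_on ?e ?D'"
      using bij' by (rule bij_betw_imp_inj_on)
    show "carrier ?G' \<subseteq> ?D'"
      by (auto simp: barr_cocycles_def barr_cochains_def)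
    show "?H' \<subseteq> ?D'"
      unfolding image_barr_coboundaries_5 [symmetric] bij_betw_imp_surj_on [OF bij, symmetric]
      using barr_coboundaries_5_subset by (rule image_mono)
    fix f g
    assume f: "f \<in> ?D'" and g: "g \<in> ?D'"
    show "f \<otimes>\<^bsub>?G'\<^esub> g \<in> ?D'"
      using ZN.hochschild_cochains_mult_closed [OF f g] by simp
    have e: "?e f \<in> ?D" "?e g \<in> ?D" "?r (?e f) = f" "?r (?e g) = g"
      using f g bij' bij_betw_inv_into_right [OF bij] by (auto dest: bij_betwE)
    have "?r (?e f \<otimes>\<^bsub>?G\<^esub> ?e g) = ?r (?e f) \<otimes>\<^bsub>?G'\<^esub> ?r (?e g)"
      by (auto simp: ZN.word_functions_simps Zx.word_functions_simps monomial_restriction_def fun_eq_iff)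
    then have "?r (?e f \<otimes>\<^bsub>?G\<^esub> ?e g) = f \<otimes>\<^bsub>?G'\<^esub> g"
      by (simp only: e)
    moreover have "?e f \<otimes>\<^bsub>?G\<^esub> ?e g \<in> ?D"
      using Zx.hochschild_cochains_mult_closed [OF e(1,2)] by simp
    ultimately show "?e (f \<otimes>\<^bsub>?G'\<^esub> g) = ?e f \<otimes>\<^bsub>?G\<^esub> ?e g"
      using bij_betw_inv_into_left [OF bij] by metis
  next
    show "?e ` carrier ?G' = carrier ?G"
      using e_image [OF G] by (simp add: image_barr_cocycles_5)
    show "?e ` ?H' = ?H"
      using e_image [OF barr_coboundaries_5_subset] by (simp add: image_barr_coboundaries_5)
  qed
  then show ?thesis
    unfolding Barr_def by (rule is_isoI)
qed

section \<open>A nontrivial class\<close>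

abbreviation letter :: "int poly \<Rightarrow> unit \<times> int poly"
  where "letter p \<equiv> ((), p)"

text \<open>The coefficient of \<open>(x - 1)\<^sup>k\<close> in \<open>p\<close>, modulo 2. With respect to these coefficients the
  action of \<open>Zx\<close> on the two-element module becomes the augmentation at the origin.\<close>

definition taylor_coeff :: "nat \<Rightarrow> int poly \<Rightarrow> bit"
  where "taylor_coeff k p = of_int (coeff (pcompose p [:1, 1:]) k)"

lemma taylor_coeff_add: "taylor_coeff k (p + q) = taylor_coeff k p + taylor_coeff k q"
  by (simp add: taylor_coeff_def pcompose_add)

lemma taylor_coeff_0: "taylor_coeff 0 p = of_int (poly p 1)"
  by (simp add: taylor_coeff_def poly_0_coeff_0 [symmetric] poly_pcompose)

lemma taylor_coeff_mult:
  "taylor_coeff k (p * q) = (\<Sum>i \<le> k. taylor_coeff i p * taylor_coeff (k - i) q)"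
  by (simp add: taylor_coeff_def pcompose_mult coeff_mult)

lemma taylor_coeff_2_mult:
  "taylor_coeff 2 (p * q) =
    taylor_coeff 2 p * of_int (poly q 1) + taylor_coeff 1 p * taylor_coeff 1 q +
    of_int (poly p 1) * taylor_coeff 2 q"
  by (simp add: taylor_coeff_mult taylor_coeff_0 [symmetric] numeral_2_eq_2 ac_simps)

lemma taylor_coeff_power: "taylor_coeff k ([:-1, 1:] ^ i) = (if i = k then 1 else 0)"
proof -
  have "pcompose ([:-1, 1:] ^ i) [:1, 1:] = (monom 1 i :: int poly)"
  proof (induction i)
    case 0
    show ?case
      by (simp add: one_pCons [symmetric] monom_0 pcompose_1)
  next
    case (Suc i)
    have "pcompose [:-1, 1:] [:1, 1:] = ([:0, 1:] :: int poly)"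
      by (simp add: pcompose_pCons)
    then show ?case
      by (simp only: power_Suc pcompose_mult Suc.IH) (simp add: monom_Suc)
  qed
  then show ?thesis
    by (simp add: taylor_coeff_def)
qed

lemma letter_act_letter:
  "letter_act trivial_degrees F2_over_Zx (letter p) w v = of_int (poly p 1) * v"
  by (simp add: letter_act_def F2_over_Zx_def)

lemma intervals_from_1: "{Suc 0..4} = {1, 2, 3, 4 :: nat}" "{Suc 0..5} = {1, 2, 3, 4, 5 :: nat}"
  by auto

lemma hochschild_diff_4:
  "hochschild_diff trivial_degrees Zx F2_over_Zx 4 s [letter a, letter b, letter c, letter d, letter e] =
    of_int (poly a 1) * s [letter b, letter c, letter d, letter e] +
    s [letter (a * b), letter c, letter d, letter e] +
    s [letter a, letter (b * c), letter d, letter e] +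
    s [letter a, letter b, letter (c * d), letter e] +
    s [letter a, letter b, letter c, letter (d * e)] +
    of_int (poly e 1) * s [letter a, letter b, letter c, letter d]"
  by (subst Zx.hochschild_diff_eq, simp) (simp add: intervals_from_1 letter_act_letter merge_def Zx_def ac_simps)

lemma hochschild_diff_5:
  "hochschild_diff trivial_degrees Zx F2_over_Zx 5 s [letter a, letter b, letter c, letter d, letter e, letter f] =
    of_int (poly a 1) * s [letter b, letter c, letter d, letter e, letter f] +
    s [letter (a * b), letter c, letter d, letter e, letter f] +
    s [letter a, letter (b * c), letter d, letter e, letter f] +
    s [letter a, letter b, letter (c * d), letter e, letter f] +
    s [letter a, letter b, letter c, letter (d * e), letter f] +
    s [letter a, letter b, letter c, letter d, letter (e * f)] +
    of_int (poly f 1) * s [letter a, letter b, letter c, letter d, letter e]"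
  by (subst Zx.hochschild_diff_eq, simp) (simp add: intervals_from_1 letter_act_letter merge_def Zx_def ac_simps)

lemma hochschild_diff_diff_4:
  assumes "length w = 6"
  shows "hochschild_diff trivial_degrees Zx F2_over_Zx 5 (hochschild_diff trivial_degrees Zx F2_over_Zx 4 s) w = 0"
proof -
  obtain a b c d e f where w: "w = [letter a, letter b, letter c, letter d, letter e, letter f]"
    using assms by (auto simp: length_Suc_conv numeral_eq_Suc)
  show ?thesis
    unfolding w hochschild_diff_5 hochschild_diff_4 by (simp add: algebra_simps)
qed

definition quadratic_cochain :: "(unit \<times> int poly) list \<Rightarrow> bit"
  where "quadratic_cochain w = (\<Prod>l \<leftarrow> w. taylor_coeff 2 (snd l))"

text \<open>As a Hochschild coboundary this is a cocycle; it may represent a nonzero class, since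
  \<^const>\<open>quadratic_cochain\<close> is not a Barr cochain.\<close>

definition exotic_cocycle :: "(unit \<times> int poly) list \<Rightarrow> bit"
  where "exotic_cocycle = hochschild_diff trivial_degrees Zx F2_over_Zx 4 quadratic_cochain"

lemma multiadditive_quadratic_cochain: "multiadditive n quadratic_cochain"
  by (simp add: multiadditive_def quadratic_cochain_def taylor_coeff_add algebra_simps)

text \<open>Modulo the augmentation, \<open>q(ab) = e(a)e(b)\<close>; the terms that involve the augmentation occur twice and cancel.\<close>

lemma exotic_cocycle_eq:
  "exotic_cocycle [letter a, letter b, letter c, letter d, letter e] =
    taylor_coeff 1 a * taylor_coeff 1 b * taylor_coeff 2 c * taylor_coeff 2 d * taylor_coeff 2 e +
    taylor_coeff 2 a * taylor_coeff 1 b * taylor_coeff 1 c * taylor_coeff 2 d * taylor_coeff 2 e +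
    taylor_coeff 2 a * taylor_coeff 2 b * taylor_coeff 1 c * taylor_coeff 1 d * taylor_coeff 2 e +
    taylor_coeff 2 a * taylor_coeff 2 b * taylor_coeff 2 c * taylor_coeff 1 d * taylor_coeff 1 e"
  by (simp add: exotic_cocycle_def hochschild_diff_4 quadratic_cochain_def taylor_coeff_2_mult algebra_simps)

lemma harrison_exotic_cocycle: "harrison 5 exotic_cocycle"
proof -
  have one: "shuffle_sum exotic_cocycle [letter a] [letter b, letter c, letter d, letter e] = 0" for a b c d e
    by (simp add: exotic_cocycle_eq algebra_simps)
  have two: "shuffle_sum exotic_cocycle [letter a, letter b] [letter c, letter d, letter e] = 0" for a b c d e
    by (simp add: exotic_cocycle_eq algebra_simps)
  have short: "shuffle_sum exotic_cocycle u v = 0"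
    if "length u \<le> 2" "u \<noteq> []" "length u + length v = 5" for u v
  proof -
    from that consider "length u = Suc 0" "length v = Suc (Suc (Suc (Suc 0)))"
      | "length u = Suc (Suc 0)" "length v = Suc (Suc (Suc 0))"
      by (cases u) (auto simp: le_Suc_eq numeral_eq_Suc)
    then show ?thesis
      by cases (auto simp: length_Suc_conv one two simp del: shuffle_sum.simps)
  qed
  show ?thesis
    unfolding harrison_def
  proof (intro allI impI, elim conjE)
    fix u v :: "(unit \<times> int poly) list"
    assume "u \<noteq> []" "v \<noteq> []" "length u + length v = 5"
    then show "shuffle_sum exotic_cocycle u v = 0"
      using short [of u v] short [of v u] by (cases "length u \<le> 2") (simp_all add: shuffle_sum_commute)
  qed
qed

lemma exotic_cocycle_in_barr_cocycles:
  "exotic_cocycle \<in> barr_cocycles trivial_degrees \<Z> Zx F2_over_Zx 5"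
proof -
  have "multiadditive (Suc 4) exotic_cocycle" "exotic_cocycle \<in> extensional {w. length w = Suc 4}"
    unfolding exotic_cocycle_def
    by (rule Zx.multiadditive_hochschild_diff [OF multiadditive_quadratic_cochain])
      (rule Zx.hochschild_diff_extensional)
  moreover have "hochschild_diff trivial_degrees Zx F2_over_Zx 5 exotic_cocycle w = 0" if "length w = Suc 5" for w
    using hochschild_diff_diff_4 [of w] that by (simp add: exotic_cocycle_def)
  ultimately show ?thesis
    by (simp add: Zx.barr_cocycles_iff Zx.barr_cochains_5 Zx.hochschild_cochains_eq harrison_exotic_cocycle)
qed

text \<open>In the words of powers of \<open>t = x - 1\<close>, the boundary of the test chain is
  \<open>[2|2|2|2] + [1|3|1|3]\<close>, the shuffles of \<open>[2]\<close> with \<open>[1|1|4]\<close> and of \<open>[1]\<close> with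
  \<open>[2|2|3]\<close>, and \<open>[2|2|3|1] + [1|3|2|2]\<close>. The last two words are the reversals of each other; a word
  and its reversal always agree modulo shuffles, up to sign. Here this takes the
  shuffles of \<open>[2]\<close> with \<open>[2|3|1]\<close>, of \<open>[2|2]\<close> with \<open>[3|1]\<close> and of \<open>[3|2|2]\<close> with \<open>[1]\<close>.\<close>

lemma exotic_cocycle_not_coboundary:
  "exotic_cocycle \<notin> barr_coboundaries trivial_degrees \<Z> Zx F2_over_Zx 5"
proof
  assume "exotic_cocycle \<in> barr_coboundaries trivial_degrees \<Z> Zx F2_over_Zx 5"
  then obtain s where "s \<in> barr_cochains trivial_degrees \<Z> Zx F2_over_Zx 4"
    and diff: "exotic_cocycle = hochschild_diff trivial_degrees Zx F2_over_Zx 4 s"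
    by (auto simp: barr_coboundaries_def)
  then have harrison: "harrison 4 s" and squares: "\<And>a b. s [a, b, a, b] = 0"
    unfolding Zx.barr_cochains_4 by blast+
  define T where "T i = letter ([:-1, 1:] ^ i)" for i :: nat
  have shuffle_1_3: "s [T i, T j, T k, T l] + s [T j, T i, T k, T l] + s [T j, T k, T i, T l] + s [T j, T k, T l, T i] = 0"
    for i j k l
    using harrisonD [OF harrison, of "[T i]" "[T j, T k, T l]"] by (simp add: ac_simps)
  have shuffle_2_2: "s [T i, T j, T k, T l] + s [T i, T k, T j, T l] + s [T i, T k, T l, T j] +
      s [T k, T i, T j, T l] + s [T k, T i, T l, T j] + s [T k, T l, T i, T j] = 0" for i j k l
    using harrisonD [OF harrison, of "[T i, T j]" "[T k, T l]"] by (simp add: ac_simps)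
  have diff_T: "exotic_cocycle [T i, T j, T k, T l, T m] =
      s [T (i + j), T k, T l, T m] + s [T i, T (j + k), T l, T m] +
      s [T i, T j, T (k + l), T m] + s [T i, T j, T k, T (l + m)]"
    if "0 < i" "0 < m" for i j k l m
    using that by (simp add: diff T_def hochschild_diff_4 power_add)
  have value_T: "exotic_cocycle [T i, T j, T k, T l, T m] =
      of_bool ((i, j, k, l, m) \<in> {(1, 1, 2, 2, 2), (2, 1, 1, 2, 2), (2, 2, 1, 1, 2), (2, 2, 2, 1, 1)})" for i j k l m
    unfolding T_def exotic_cocycle_eq taylor_coeff_power by auto
  have "exotic_cocycle [T 1, T 1, T 1, T 1, T 4] + exotic_cocycle [T 1, T 1, T 1, T 2, T 3] +
      exotic_cocycle [T 1, T 1, T 2, T 1, T 3] + exotic_cocycle [T 1, T 1, T 2, T 2, T 2] = 0"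
  proof -
    let ?l = "\<lambda>i j k l. s [T i, T j, T k, T l] + s [T j, T i, T k, T l] + s [T j, T k, T i, T l] + s [T j, T k, T l, T i]"
    have "exotic_cocycle [T 1, T 1, T 1, T 1, T 4] + exotic_cocycle [T 1, T 1, T 1, T 2, T 3] +
        exotic_cocycle [T 1, T 1, T 2, T 1, T 3] + exotic_cocycle [T 1, T 1, T 2, T 2, T 2] =
      s [T 2, T 2, T 2, T 2] + s [T 1, T 3, T 1, T 3] + ?l 2 1 1 4 + ?l 1 2 2 3 +
      ?l 2 2 3 1 + ?l 1 3 2 2 +
      (s [T 2, T 2, T 3, T 1] + s [T 2, T 3, T 2, T 1] + s [T 2, T 3, T 1, T 2] +
       s [T 3, T 2, T 2, T 1] + s [T 3, T 2, T 1, T 2] + s [T 3, T 1, T 2, T 2])"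
      by (simp add: diff_T ac_simps del: One_nat_def)
    also have "\<dots> = 0"
      by (simp only: shuffle_1_3 shuffle_2_2 squares add_0_right)
    finally show ?thesis .
  qed
  then show False
    by (simp add: value_T)
qed

lemma zero_in_barr_coboundaries:
  "(\<lambda>w \<in> {w. length w = 5}. 0) \<in> barr_coboundaries nat_degrees \<Z> ZN constant_F2 5"
proof -
  let ?z = "\<lambda>w \<in> {w :: (nat \<times> int) list. length w = 4}. 0 :: bit"
  have "shuffle_sum ?z u v = 0" if "length u + length v = 4" for u v
  proof -
    have "shuffle_sum ?z u v = shuffle_sum (\<lambda>_. 0) u v"
      by (rule shuffle_sum_cong) (simp add: that)
    also have "\<dots> = 0"
      using shuffle_sum_add [of "\<lambda>_. 0 :: bit" "\<lambda>_. 0" u v] by simp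
    finally show ?thesis .
  qed
  then have z: "?z \<in> barr_cochains nat_degrees \<Z> ZN constant_F2 4"
    by (simp add: ZN.barr_cochains_4 ZN.hochschild_cochains_eq multiadditive_def harrison_def)
  have "hochschild_diff nat_degrees ZN constant_F2 4 ?z = (\<lambda>w \<in> {w. length w = 5}. 0)"
  proof (rule extensionalityI [where A = "{w. length w = Suc 4}"])
    fix w :: "(nat \<times> int) list"
    assume "w \<in> {w. length w = Suc 4}"
    then have w: "length w = Suc 4"
      by simp
    have "?z (merge nat_degrees ZN i w) = 0" if "i \<in> {1..4}" for i
      using that w by (auto simp: merge_def min_def split: prod.split)
    then have sum: "(\<Sum>i = 1..4. ?z (merge nat_degrees ZN i w)) = 0"
      by (intro sum.neutral) blast
    have act: "letter_act nat_degrees constant_F2 u v 0 = 0" for u v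
      by (simp add: letter_act_def constant_F2_def)
    show "hochschild_diff nat_degrees ZN constant_F2 4 ?z w = (\<lambda>w \<in> {w. length w = 5}. 0) w"
      unfolding ZN.hochschild_diff_eq [OF w] sum using w by (simp add: act)
  qed (use ZN.hochschild_diff_extensional [of 4 ?z] in simp_all)
  then have "(\<lambda>w \<in> {w. length w = 5}. 0) \<in>
      hochschild_diff nat_degrees ZN constant_F2 4 ` barr_cochains nat_degrees \<Z> ZN constant_F2 4"
    using z by (rule image_eqI [OF sym])
  then show ?thesis
    by (simp add: barr_coboundaries_def)
qed

text \<open>The coset of the pulled back class contains that class, because 0 is a coboundary, and hence is not
  the neutral element, which is the set of all coboundaries.\<close>

lemma Barr_5_ZN_nontrivial:
  "carrier (Barr nat_degrees \<Z> ZN constant_F2 5) \<noteq> {\<one>\<^bsub>Barr nat_degrees \<Z> ZN constant_F2 5\<^esub>}"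
proof -
  let ?D = "hochschild_cochains trivial_degrees \<Z> Zx F2_over_Zx 5"
  let ?G = "(word_functions nat_degrees ZN constant_F2 5)\<lparr>carrier := barr_cocycles nat_degrees \<Z> ZN constant_F2 5\<rparr>"
  let ?H = "barr_coboundaries nat_degrees \<Z> ZN constant_F2 5"
  define f where "f = monomial_restriction 5 exotic_cocycle"
  have inj: "inj_on (monomial_restriction 5) ?D"
    using bij_betw_monomial_restriction by (rule bij_betw_imp_inj_on)
  have "exotic_cocycle \<in> ?D"
    using exotic_cocycle_in_barr_cocycles by (auto simp: barr_cocycles_def barr_cochains_def)
  then have "f \<notin> ?H"
    unfolding f_def image_barr_coboundaries_5 [symmetric]
    using inj_on_image_mem_iff [OF inj _ barr_coboundaries_5_subset] exotic_cocycle_not_coboundary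
    by blast
  have f: "f \<in> carrier ?G"
    using exotic_cocycle_in_barr_cocycles by (auto simp: f_def image_barr_cocycles_5 [symmetric])
  have "(\<lambda>w \<in> {w. length w = 5}. 0) \<otimes>\<^bsub>?G\<^esub> f = f"
    by (auto simp: ZN.word_functions_simps f_def monomial_restriction_def fun_eq_iff)
  then have "f \<in> ?H #>\<^bsub>?G\<^esub> f"
    using zero_in_barr_coboundaries unfolding r_coset_def by force
  with \<open>f \<notin> ?H\<close> have "?H #>\<^bsub>?G\<^esub> f \<noteq> ?H"
    by blast
  moreover have "?H #>\<^bsub>?G\<^esub> f \<in> carrier (?G Mod ?H)"
    using f by (auto simp: FactGroup_def RCOSETS_def)
  moreover have "\<one>\<^bsub>?G Mod ?H\<^esub> = ?H"
    by (simp add: FactGroup_def)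
  ultimately show ?thesis
    unfolding Barr_def by auto
qed

theorem mainTheorem3:
  shows "Barr nat_degrees \<Z> ZN constant_F2 5 \<cong> Barr trivial_degrees \<Z> Zx F2_over_Zx 5 \<and>
    carrier (Barr nat_degrees \<Z> ZN constant_F2 5) \<noteq> {\<one>\<^bsub>Barr nat_degrees \<Z> ZN constant_F2 5\<^esub>}"
  using Barr_5_iso Barr_5_ZN_nontrivial by blast

end
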